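(* Let $t_\alpha$, $\alpha\in R^+$, be commuting variables indexed by the positive roots. For $\lambda\in P^+$ define $$R_\lambda(x;t_\alpha)=\sum_{w\in W}w\Big(x^\lambda\prod_{\alpha\in R^+}\frac{1-t_\alpha x^{-\alpha}}{1-x^{-\alpha}}\Big)\qquad\text{and}\qquad W_\lambda(t_\alpha)=\sum_{w\in W_\lambda}\Big(\prod_{\alpha\in R(w)}t_\alpha\Big),$$ where $W$ acts on the $x^\mu$ and fixes the $t_\alpha$, and $R(w)=\{\alpha\in R^+: w\alpha\in -R^+\}$. Then (a) $\displaystyle R_\lambda(x;t_\alpha)=\sum_{\mu\in P^+}u_{\lambda\mu}s_\mu$ with $u_{\lambda\mu}\in\mathbb Z[t_\alpha]$ (polynomials in all the $t_\alpha$, $\alpha\in R^+$), $u_{\lambda\mu}=0$ unless $\mu\le\lambda$, and $u_{\lambda\lambda}=W_\lambda(t_\alpha)$. (b) $\displaystyle P_\lambda(x;t)=\sum_{\mu\in P^+}c_{\lambda\mu}s_\mu$ with $c_{\lambda\mu}\in\mathbb Z[t]$, $c_{\lambda\mu}=0$ unless $\mu\le\lambda$, and $c_{\lambda\lambda}=1$.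
   Context: $R$ is a reduced irreducible root system spanning a finite-dimensional real vector space with nondegenerate symmetric bilinear form $\langle\,,\rangle$; $\alpha^\vee=2\alpha/\langle\alpha,\alpha\rangle$; $W$ is the Weyl group, $R^+$ a choice of positive roots, $\ell$ the length function. $P=\{\lambda:\langle\lambda,\alpha^\vee\rangle\in\mathbb Z\ \forall\alpha\in R\}$, $P^+=\{\lambda\in P:\langle\lambda,\alpha^\vee\rangle\ge0\ \forall\alpha\in R^+\}$, $\rho=\frac12\sum_{\alpha\in R^+}\alpha$. Dominance order on $P$: $\mu\le\lambda$ iff $\lambda-\mu$ is a sum of (zero or more) positive roots. For $\lambda\in P$, $W_\lambda=\{w\in W:w\lambda=\lambda\}$ and $W_\lambda(t)=\sum_{w\in W_\lambda}t^{\ell(w)}$. The group algebra of $P$ has basis $x^\lambda$ ($\lambda\in P$), $x^\lambda x^\mu=x^{\lambda+\mu}$, with $W$-action $wx^\lambda=x^{w\lambda}$. With $a_\mu=\sum_{w\in W}(-1)^{\ell(w)}x^{w\mu}$, the Weyl character is $s_\mu=a_{\mu+\rho}/a_\rho$. The Macdonald spherical function (Hall-Littlewood polynomial) is $$P_\lambda(x;t)=\frac1{W_\lambda(t)}\sum_{w\in W}w\Big(x^\lambda\prod_{\alpha\in R^+}\frac{1-tx^{-\alpha}}{1-x^{-\alpha}}\Big).$$ *)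

theory Defs
  imports
    "HOL-Analysis.Analysis"
    "HOL-Computational_Algebra.Computational_Algebra"
    "HOL-Library.Poly_Mapping"
begin

section \<open>Unique product monoids\<close>

text \<open>
  The library proves that \<open>'m \<Rightarrow>\<^sub>0 'c\<close> (with convolution) is an integral domain only for linearly
  ordered \<open>'m\<close>. The lattice of weights and the monoid of exponents of monomials carry no canonical
  order, so we use the weaker unique product property.
\<close>

class unique_product_monoid = comm_monoid_add +
  assumes unique_product:
    "finite A \<Longrightarrow> finite B \<Longrightarrow> A \<noteq> {} \<Longrightarrow> B \<noteq> {} \<Longrightarrow>
      \<exists>a\<in>A. \<exists>b\<in>B. \<forall>a'\<in>A. \<forall>b'\<in>B. a' + b' = a + b \<longrightarrow> a' = a \<and> b' = b"

instance nat :: unique_product_monoid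
proof
  fix A B :: "nat set"
  assume *: "finite A" "finite B" "A \<noteq> {}" "B \<noteq> {}"
  have "a' = Max A \<and> b' = Max B" if "a' \<in> A" "b' \<in> B" "a' + b' = Max A + Max B" for a' b'
    using that Max_ge[OF *(1) that(1)] Max_ge[OF *(2) that(2)] by linarith
  then show "\<exists>a\<in>A. \<exists>b\<in>B. \<forall>a'\<in>A. \<forall>b'\<in>B. a' + b' = a + b \<longrightarrow> a' = a \<and> b' = b"
    using Max_in[OF *(1,3)] Max_in[OF *(2,4)] by blast
qed

lemma linear_functional_nonzero_on_finite:
  fixes D :: "'v::real_vector set"
  assumes "finite D" "0 \<notin> D"
  shows "\<exists>f::'v \<Rightarrow> real. linear f \<and> (\<forall>d\<in>D. f d \<noteq> 0)"
  using assms
proof (induction D)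
  case empty
  show ?case using linear_zero by blast
next
  case (insert d D)
  then obtain f :: "'v \<Rightarrow> real" where f: "linear f" "\<forall>d\<in>D. f d \<noteq> 0" by auto
  have "d \<noteq> 0" using insert by auto
  then have "independent {d}" by simp
  then obtain g :: "'v \<Rightarrow> real" where g: "linear g" "g d = 1"
    using linear_independent_extend[of "{d}" "\<lambda>_. 1"] by auto
  have "finite ((\<lambda>x. - f x / g x) ` insert d D)" using insert by simp
  then obtain e where e: "e \<notin> (\<lambda>x. - f x / g x) ` insert d D" "e \<noteq> 0"
    using ex_new_if_finite[OF infinite_UNIV_char_0, of "insert 0 ((\<lambda>x. - f x / g x) ` insert d D)"]
    by auto
  have "linear (\<lambda>x. f x + e * g x)"
    using linear_compose_add[OF f(1) linear_compose_scale_right[OF g(1), of e]] by simp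
  moreover have "f x + e * g x \<noteq> 0" if "x \<in> insert d D" for x
  proof (cases "g x = 0")
    case True
    with g that f show ?thesis by auto
  next
    case False
    have "e \<noteq> - f x / g x" using e that by blast
    with False show ?thesis by (simp add: field_simps add_eq_0_iff2)
  qed
  ultimately show ?case by blast
qed

instance real_vector \<subseteq> unique_product_monoid
proof
  fix A B :: "'a set"
  assume *: "finite A" "finite B" "A \<noteq> {}" "B \<noteq> {}"
  let ?D = "(\<lambda>(x, y). x - y) ` ((A \<union> B) \<times> (A \<union> B)) - {0}"
  obtain f :: "'a \<Rightarrow> real" where f: "linear f" "\<forall>d\<in>?D. f d \<noteq> 0"
    using linear_functional_nonzero_on_finite[of ?D] * by auto
  have inj: "x = y" if "x \<in> A \<union> B" "y \<in> A \<union> B" "f x = f y" for x y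
  proof (rule ccontr)
    assume "x \<noteq> y"
    with that(1,2) have "x - y \<in> ?D" by force
    with f(2) have "f (x - y) \<noteq> 0" by blast
    with that(3) show False by (simp add: linear_diff[OF f(1)])
  qed
  have max: "\<exists>a\<in>S. \<forall>a'\<in>S. f a' \<le> f a" if "finite S" "S \<noteq> {}" for S
  proof -
    have "Max (f ` S) \<in> f ` S" using that by (intro Max_in) auto
    then obtain a where "a \<in> S" "f a = Max (f ` S)" by auto
    then show ?thesis using that(1) by (metis Max_ge finite_imageI imageI)
  qed
  obtain a where a: "a \<in> A" "\<forall>a'\<in>A. f a' \<le> f a" using max * by blast
  obtain b where b: "b \<in> B" "\<forall>b'\<in>B. f b' \<le> f b" using max * by blast
  have "a' = a \<and> b' = b" if "a' \<in> A" "b' \<in> B" "a' + b' = a + b" for a' b'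
  proof -
    have "f a' + f b' = f a + f b" using that(3) by (metis f(1) linear_add)
    moreover have "f a' \<le> f a" "f b' \<le> f b" using a b that by auto
    ultimately have "f a' = f a" "f b' = f b" by linarith+
    then show ?thesis using inj a b that by blast
  qed
  then show "\<exists>a\<in>A. \<exists>b\<in>B. \<forall>a'\<in>A. \<forall>b'\<in>B. a' + b' = a + b \<longrightarrow> a' = a \<and> b' = b"
    using a b by blast
qed

lemma poly_mapping_unique_product:
  fixes A B :: "('a \<Rightarrow>\<^sub>0 'b::unique_product_monoid) set"
  assumes "finite S" "finite A" "finite B" "A \<noteq> {}" "B \<noteq> {}"
    and "\<And>f g x. f \<in> A \<Longrightarrow> g \<in> A \<Longrightarrow> x \<notin> S \<Longrightarrow> Poly_Mapping.lookup f x = Poly_Mapping.lookup g x"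
    and "\<And>f g x. f \<in> B \<Longrightarrow> g \<in> B \<Longrightarrow> x \<notin> S \<Longrightarrow> Poly_Mapping.lookup f x = Poly_Mapping.lookup g x"
  shows "\<exists>a\<in>A. \<exists>b\<in>B. \<forall>a'\<in>A. \<forall>b'\<in>B. a' + b' = a + b \<longrightarrow> a' = a \<and> b' = b"
  using assms
proof (induction S arbitrary: A B)
  case empty
  have "f = g" if "f \<in> A" "g \<in> A" for f g
    using empty.prems(5)[OF that] by (auto intro: poly_mapping_eqI)
  moreover have "f = g" if "f \<in> B" "g \<in> B" for f g
    using empty.prems(6)[OF that] by (auto intro: poly_mapping_eqI)
  ultimately show ?case using empty.prems(3,4) by blast
next
  case (insert x S)
  let ?l = "\<lambda>f. Poly_Mapping.lookup f x"
  obtain p q where p: "p \<in> ?l ` A" and q: "q \<in> ?l ` B"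
    and pq: "\<And>p' q'. p' \<in> ?l ` A \<Longrightarrow> q' \<in> ?l ` B \<Longrightarrow> p' + q' = p + q \<Longrightarrow> p' = p \<and> q' = q"
    using unique_product[of "?l ` A" "?l ` B"] insert.prems by (metis finite_imageI image_is_empty)
  let ?A = "{f \<in> A. ?l f = p}" and ?B = "{f \<in> B. ?l f = q}"
  have "\<exists>a\<in>?A. \<exists>b\<in>?B. \<forall>a'\<in>?A. \<forall>b'\<in>?B. a' + b' = a + b \<longrightarrow> a' = a \<and> b' = b"
  proof (rule insert.IH)
    show "finite ?A" "finite ?B" using insert.prems by auto
    show "?A \<noteq> {}" "?B \<noteq> {}" using p q by auto
    show "Poly_Mapping.lookup f y = Poly_Mapping.lookup g y"
      if "f \<in> ?A" "g \<in> ?A" "y \<notin> S" for f g y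
      using insert.prems(5)[of f g y] that by (cases "y = x") auto
    show "Poly_Mapping.lookup f y = Poly_Mapping.lookup g y"
      if "f \<in> ?B" "g \<in> ?B" "y \<notin> S" for f g y
      using insert.prems(6)[of f g y] that by (cases "y = x") auto
  qed
  then obtain a b where ab: "a \<in> ?A" "b \<in> ?B"
    and u: "\<And>a' b'. a' \<in> ?A \<Longrightarrow> b' \<in> ?B \<Longrightarrow> a' + b' = a + b \<Longrightarrow> a' = a \<and> b' = b"
    by blast
  have "a' = a \<and> b' = b" if "a' \<in> A" "b' \<in> B" "a' + b' = a + b" for a' b'
  proof -
    have "?l a' + ?l b' = p + q" using arg_cong[OF that(3), of ?l] ab by (simp add: lookup_add)
    then have "?l a' = p \<and> ?l b' = q" using pq that by blast
    then show ?thesis using u[of a' b'] that by simp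
  qed
  then show ?case using ab by blast
qed

instance poly_mapping :: (type, unique_product_monoid) unique_product_monoid
proof
  fix A B :: "('a \<Rightarrow>\<^sub>0 'b) set"
  assume *: "finite A" "finite B" "A \<noteq> {}" "B \<noteq> {}"
  let ?S = "\<Union>f\<in>A \<union> B. Poly_Mapping.keys f"
  have "finite ?S" using * by auto
  moreover have "Poly_Mapping.lookup f x = Poly_Mapping.lookup g x"
    if "f \<in> A \<union> B" "g \<in> A \<union> B" "x \<notin> ?S" for f g x
    using that by (metis UN_I in_keys_iff)
  ultimately show "\<exists>a\<in>A. \<exists>b\<in>B. \<forall>a'\<in>A. \<forall>b'\<in>B. a' + b' = a + b \<longrightarrow> a' = a \<and> b' = b"
    using poly_mapping_unique_product[of ?S A B] * by blast
qed


section \<open>Monoid algebras\<close>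

text \<open>
  A copy of the library's convolution algebra \<open>'m \<Rightarrow>\<^sub>0 'c\<close>, needed because the existing \<open>idom\<close>
  instance (for linearly ordered \<open>'m\<close>) excludes another one on the same type constructor.
\<close>

typedef (overloaded) ('m, 'c) monoid_algebra = "UNIV :: ('m \<Rightarrow>\<^sub>0 'c::zero) set"
  morphisms to_poly_mapping of_poly_mapping
  by simp

setup_lifting type_definition_monoid_algebra

lift_definition mon :: "'c \<Rightarrow> 'm \<Rightarrow> ('m, 'c::zero) monoid_algebra"
  is "\<lambda>c m. Poly_Mapping.single m c" .

instantiation monoid_algebra :: (comm_monoid_add, comm_ring_1) comm_ring_1
begin
lift_definition zero_monoid_algebra :: "('a, 'b) monoid_algebra" is 0 .
lift_definition one_monoid_algebra :: "('a, 'b) monoid_algebra" is 1 .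
lift_definition plus_monoid_algebra ::
  "('a, 'b) monoid_algebra \<Rightarrow> ('a, 'b) monoid_algebra \<Rightarrow> ('a, 'b) monoid_algebra" is "(+)" .
lift_definition minus_monoid_algebra ::
  "('a, 'b) monoid_algebra \<Rightarrow> ('a, 'b) monoid_algebra \<Rightarrow> ('a, 'b) monoid_algebra" is "(-)" .
lift_definition uminus_monoid_algebra ::
  "('a, 'b) monoid_algebra \<Rightarrow> ('a, 'b) monoid_algebra" is uminus .
lift_definition times_monoid_algebra ::
  "('a, 'b) monoid_algebra \<Rightarrow> ('a, 'b) monoid_algebra \<Rightarrow> ('a, 'b) monoid_algebra" is "(*)" .
instance
  by (standard; transfer; simp add: algebra_simps)
end

lemma mon_mult: "mon c m * mon d n = mon (c * d) (m + n)"
  by transfer (simp add: mult_single)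

lemma mon_one: "mon 1 0 = 1"
  by transfer simp

lemma poly_mapping_no_zero_divisors:
  fixes f g :: "'m::unique_product_monoid \<Rightarrow>\<^sub>0 'c::idom"
  assumes "f \<noteq> 0" "g \<noteq> 0"
  shows "f * g \<noteq> 0"
proof -
  let ?A = "Poly_Mapping.keys f" and ?B = "Poly_Mapping.keys g"
  obtain a b where ab: "a \<in> ?A" "b \<in> ?B"
    and u: "\<And>a' b'. a' \<in> ?A \<Longrightarrow> b' \<in> ?B \<Longrightarrow> a' + b' = a + b \<Longrightarrow> a' = a \<and> b' = b"
    using unique_product[of ?A ?B] assms by (metis finite_keys keys_eq_empty)
  have "Poly_Mapping.lookup (f * g) (a + b) =
      prod_fun (Poly_Mapping.lookup f) (Poly_Mapping.lookup g) (a + b)"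
    by (simp add: times_poly_mapping.rep_eq)
  also have "\<dots> = (\<Sum>(a', b'). Poly_Mapping.lookup f a' * Poly_Mapping.lookup g b' when a + b = a' + b')"
    by (rule prod_fun_unfold_prod) simp_all
  also have "\<dots> = (\<Sum>x. (case x of (a', b') \<Rightarrow> Poly_Mapping.lookup f a' * Poly_Mapping.lookup g b') when (a, b) = x)"
  proof (rule Sum_any.cong)
    fix x :: "'m \<times> 'm"
    obtain a' b' where x: "x = (a', b')" by force
    show "(case x of (a', b') \<Rightarrow> Poly_Mapping.lookup f a' * Poly_Mapping.lookup g b' when a + b = a' + b') =
      ((case x of (a', b') \<Rightarrow> Poly_Mapping.lookup f a' * Poly_Mapping.lookup g b') when (a, b) = x)"
      using u[of a' b']
      by (cases "a' \<in> ?A \<and> b' \<in> ?B") (auto simp: x when_def in_keys_iff)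
  qed
  also have "\<dots> = Poly_Mapping.lookup f a * Poly_Mapping.lookup g b"
    by simp
  also have "\<dots> \<noteq> 0" using ab by (simp add: in_keys_iff)
  finally show ?thesis by auto
qed

instance monoid_algebra :: (unique_product_monoid, idom) idom
proof
  fix a b :: "('a, 'b) monoid_algebra"
  show "a \<noteq> 0 \<Longrightarrow> b \<noteq> 0 \<Longrightarrow> a * b \<noteq> 0"
    by transfer (rule poly_mapping_no_zero_divisors)
qed

text \<open>Polynomials with integer coefficients in commuting variables indexed by \<open>'i\<close>.\<close>

type_synonym 'i int_mpoly = "('i \<Rightarrow>\<^sub>0 nat, int) monoid_algebra"

definition mvar :: "'i \<Rightarrow> 'i int_mpoly"
  where "mvar i = mon 1 (Poly_Mapping.single i 1)"

definition mpolys_in :: "'i set \<Rightarrow> 'i int_mpoly set"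
  where "mpolys_in I = {p. \<forall>m\<in>Poly_Mapping.keys (to_poly_mapping p). Poly_Mapping.keys m \<subseteq> I}"


section \<open>The fraction field of the group algebra and the action of the Weyl group\<close>

text \<open>
  The group algebra used is that of the whole vector space \<open>'v\<close>; the group algebra of the weight
  lattice is the subring spanned by the \<open>x\<^sup>\<lambda>\<close> with \<open>\<lambda>\<close> a weight. The elements below live in the
  fraction field of the former; only exponents in the weight lattice occur in them.
\<close>

abbreviation xpow :: "'v::real_vector \<Rightarrow> ('v, 'c::idom) monoid_algebra fract"
  where "xpow lam \<equiv> to_fract (mon 1 lam)"

abbreviation scalar :: "'c \<Rightarrow> ('v::real_vector, 'c::idom) monoid_algebra fract"
  where "scalar c \<equiv> to_fract (mon c 0)"

lift_definition alg_act ::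
    "('v \<Rightarrow> 'v) \<Rightarrow> ('v, 'c::comm_monoid_add) monoid_algebra \<Rightarrow> ('v, 'c) monoid_algebra"
  is "\<lambda>w p. \<Sum>k\<in>Poly_Mapping.keys p. Poly_Mapping.single (w k) (Poly_Mapping.lookup p k)" .

text \<open>
  The induced map on fractions, \<open>w (a / b) = w a / w b\<close>. It is well defined for additive injective
  \<open>w\<close>, see the lemma \<open>fract_act_Fract\<close> below.
\<close>

definition fract_act ::
    "('v \<Rightarrow> 'v) \<Rightarrow> ('v::real_vector, 'c::idom) monoid_algebra fract \<Rightarrow> ('v, 'c) monoid_algebra fract"
  where "fract_act w q = (THE r. \<forall>a b. b \<noteq> 0 \<and> q = Fract a b \<longrightarrow> r = Fract (alg_act w a) (alg_act w b))"

lemma alg_act_superset: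
  fixes p :: "'v \<Rightarrow>\<^sub>0 'c::comm_monoid_add"
  assumes "finite S" "Poly_Mapping.keys p \<subseteq> S"
  shows "(\<Sum>k\<in>Poly_Mapping.keys p. Poly_Mapping.single (w k) (Poly_Mapping.lookup p k)) =
    (\<Sum>k\<in>S. Poly_Mapping.single (w k) (Poly_Mapping.lookup p k))"
  by (rule sum.mono_neutral_left) (use assms in \<open>auto simp: in_keys_iff\<close>)

lemma alg_act_mon [simp]: "alg_act w (mon c m) = mon c (w m)"
  by transfer simp

lemma alg_act_add: "alg_act w (a + b) = alg_act w a + alg_act w b"
proof transfer
  fix w :: "'a \<Rightarrow> 'a" and a b :: "'a \<Rightarrow>\<^sub>0 'b"
  let ?S = "Poly_Mapping.keys a \<union> Poly_Mapping.keys b"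
  have "Poly_Mapping.keys (a + b) \<subseteq> ?S" by (rule Poly_Mapping.keys_add)
  then show "(\<Sum>k\<in>Poly_Mapping.keys (a + b). Poly_Mapping.single (w k) (Poly_Mapping.lookup (a + b) k)) =
    (\<Sum>k\<in>Poly_Mapping.keys a. Poly_Mapping.single (w k) (Poly_Mapping.lookup a k)) +
    (\<Sum>k\<in>Poly_Mapping.keys b. Poly_Mapping.single (w k) (Poly_Mapping.lookup b k))"
    using alg_act_superset[of ?S "a + b" w] alg_act_superset[of ?S a w] alg_act_superset[of ?S b w]
    by (simp add: lookup_add single_add sum.distrib)
qed

lemma monoid_algebra_induct [case_names zero mon add]:
  fixes p :: "('m::comm_monoid_add, 'c::comm_ring_1) monoid_algebra"
  assumes "P 0" "\<And>c m. P (mon c m)" "\<And>p q. P p \<Longrightarrow> P q \<Longrightarrow> P (p + q)"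
  shows "P p"
proof -
  have "P (of_poly_mapping f)" for f :: "'m \<Rightarrow>\<^sub>0 'c"
  proof (induction "Poly_Mapping.keys f" arbitrary: f rule: infinite_finite_induct)
    case infinite
    then show ?case by simp
  next
    case empty
    then have "f = 0" by (metis keys_eq_empty)
    then show ?case using assms(1) by (simp add: zero_monoid_algebra_def)
  next
    case (insert x F)
    let ?g = "Poly_Mapping.update x 0 f"
    have g: "F = Poly_Mapping.keys ?g"
      using insert.hyps by (metis Diff_insert_absorb keys_update)
    have f: "f = Poly_Mapping.single x (Poly_Mapping.lookup f x) + ?g"
      by (rule poly_mapping_eqI) (auto simp: lookup_add lookup_single lookup_update when_def)
    have "of_poly_mapping f = mon (Poly_Mapping.lookup f x) x + of_poly_mapping ?g"
      using arg_cong[OF f, of of_poly_mapping]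
      by (simp add: plus_monoid_algebra.abs_eq mon.abs_eq)
    then show ?case using assms(2,3) insert.hyps(3)[OF g] by metis
  qed
  then show ?thesis by (metis to_poly_mapping_inverse)
qed

lemma alg_act_mult:
  fixes a b :: "('v::real_vector, 'c::idom) monoid_algebra"
  assumes "\<And>x y. w (x + y) = w x + w y"
  shows "alg_act w (a * b) = alg_act w a * alg_act w b"
proof -
  have 0: "alg_act w (0 :: ('v, 'c) monoid_algebra) = 0"
    by transfer simp
  show ?thesis
  proof (induction a rule: monoid_algebra_induct)
    case (mon c m)
    show ?case
      by (induction b rule: monoid_algebra_induct)
        (simp_all add: 0 alg_act_add distrib_left mon_mult assms)
  qed (simp_all add: 0 alg_act_add distrib_right)
qed

lemma alg_act_eq_0_iff:
  fixes a :: "('v::real_vector, 'c::idom) monoid_algebra"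
  assumes "inj w"
  shows "alg_act w a = 0 \<longleftrightarrow> a = 0"
  using assms
proof transfer
  fix w :: "'v \<Rightarrow> 'v" and a :: "'v \<Rightarrow>\<^sub>0 'c"
  assume w: "inj w"
  let ?s = "\<Sum>k\<in>Poly_Mapping.keys a. Poly_Mapping.single (w k) (Poly_Mapping.lookup a k)"
  have "Poly_Mapping.lookup ?s (w m) = Poly_Mapping.lookup a m" for m
  proof -
    have "Poly_Mapping.lookup ?s (w m) =
      (\<Sum>k\<in>Poly_Mapping.keys a. if k = m then Poly_Mapping.lookup a k else 0)"
      by (simp add: lookup_sum lookup_single when_def inj_eq[OF w])
    also have "\<dots> = Poly_Mapping.lookup a m"
      by (simp add: in_keys_iff)
    finally show ?thesis .
  qed
  then have "a = 0" if "?s = 0"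
    using that by (intro poly_mapping_eqI) (metis lookup_zero)
  moreover have "?s = 0" if "a = 0"
    using that by simp
  ultimately show "?s = 0 \<longleftrightarrow> a = 0" by blast
qed

lemma fract_act_Fract:
  fixes a b :: "('v::real_vector, 'c::idom) monoid_algebra"
  assumes "linear w" "inj w" "b \<noteq> 0"
  shows "fract_act w (Fract a b) = Fract (alg_act w a) (alg_act w b)"
  unfolding fract_act_def
proof (rule the_equality)
  show "\<forall>c d. d \<noteq> 0 \<and> Fract a b = Fract c d \<longrightarrow>
    Fract (alg_act w a) (alg_act w b) = Fract (alg_act w c) (alg_act w d)"
  proof (intro allI impI)
    fix c d :: "('v, 'c) monoid_algebra"
    assume *: "d \<noteq> 0 \<and> Fract a b = Fract c d"
    then have "a * d = c * b"
      using eq_fract(1)[of b d a c] assms(3) by blast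
    then have "alg_act w a * alg_act w d = alg_act w c * alg_act w b"
      using alg_act_mult[of w] linear_add[OF assms(1)] by metis
    moreover have "alg_act w b \<noteq> 0" "alg_act w d \<noteq> 0"
      using * assms by (simp_all add: alg_act_eq_0_iff)
    ultimately show "Fract (alg_act w a) (alg_act w b) = Fract (alg_act w c) (alg_act w d)"
      by (simp add: eq_fract)
  qed
qed (use assms(3) in blast)


section \<open>Root systems\<close>

definition coroot :: "('v::real_vector \<Rightarrow> 'v \<Rightarrow> real) \<Rightarrow> 'v \<Rightarrow> 'v"
  where "coroot B \<alpha> = (2 / B \<alpha> \<alpha>) *\<^sub>R \<alpha>"

definition refl_root :: "('v::real_vector \<Rightarrow> 'v \<Rightarrow> real) \<Rightarrow> 'v \<Rightarrow> 'v \<Rightarrow> 'v"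
  where "refl_root B \<alpha> v = v - B v (coroot B \<alpha>) *\<^sub>R \<alpha>"

text \<open>The space is finite-dimensional because it is spanned by the finite set \<open>R\<close>.\<close>

definition reduced_irreducible_root_system ::
    "('v::real_vector \<Rightarrow> 'v \<Rightarrow> real) \<Rightarrow> 'v set \<Rightarrow> bool"
  where "reduced_irreducible_root_system B R \<longleftrightarrow>
    bilinear B \<and> (\<forall>x y. B x y = B y x) \<and> (\<forall>x. (\<forall>y. B x y = 0) \<longrightarrow> x = 0) \<and>
    finite R \<and> span R = UNIV \<and> 0 \<notin> R \<and> (\<forall>\<alpha>\<in>R. B \<alpha> \<alpha> \<noteq> 0) \<and>
    (\<forall>\<alpha>\<in>R. refl_root B \<alpha> ` R = R) \<and>
    (\<forall>\<alpha>\<in>R. \<forall>\<beta>\<in>R. B \<beta> (coroot B \<alpha>) \<in> \<int>) \<and>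
    (\<forall>\<alpha>\<in>R. \<forall>c. c *\<^sub>R \<alpha> \<in> R \<longrightarrow> c = 1 \<or> c = -1) \<and>
    R \<noteq> {} \<and>
    \<not> (\<exists>R1 R2. R1 \<noteq> {} \<and> R2 \<noteq> {} \<and> R1 \<inter> R2 = {} \<and> R1 \<union> R2 = R \<and>
        (\<forall>\<alpha>\<in>R1. \<forall>\<beta>\<in>R2. B \<alpha> \<beta> = 0))"

definition positive_system :: "'v::real_vector set \<Rightarrow> 'v set \<Rightarrow> bool"
  where "positive_system R Rp \<longleftrightarrow>
    (\<exists>f::'v \<Rightarrow> real. linear f \<and> (\<forall>\<alpha>\<in>R. f \<alpha> \<noteq> 0) \<and> Rp = {\<alpha>\<in>R. f \<alpha> > 0})"

inductive_set weyl_group :: "('v::real_vector \<Rightarrow> 'v \<Rightarrow> real) \<Rightarrow> 'v set \<Rightarrow> ('v \<Rightarrow> 'v) set"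
  for B R where
    weyl_id: "id \<in> weyl_group B R"
  | weyl_refl: "w \<in> weyl_group B R \<Longrightarrow> \<alpha> \<in> R \<Longrightarrow> refl_root B \<alpha> \<circ> w \<in> weyl_group B R"

definition simple_roots :: "'v::real_vector set \<Rightarrow> 'v set"
  where "simple_roots Rp = {\<alpha>\<in>Rp. \<not> (\<exists>\<beta>\<in>Rp. \<exists>\<gamma>\<in>Rp. \<alpha> = \<beta> + \<gamma>)}"

definition weyl_length :: "('v::real_vector \<Rightarrow> 'v \<Rightarrow> real) \<Rightarrow> 'v set \<Rightarrow> ('v \<Rightarrow> 'v) \<Rightarrow> nat"
  where "weyl_length B Rp w =
    (LEAST n. \<exists>\<alpha>s. set \<alpha>s \<subseteq> simple_roots Rp \<and> length \<alpha>s = n \<and>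
      w = foldr (\<lambda>\<alpha> g. refl_root B \<alpha> \<circ> g) \<alpha>s id)"

definition inversions :: "'v::real_vector set \<Rightarrow> ('v \<Rightarrow> 'v) \<Rightarrow> 'v set"
  where "inversions Rp w = {\<alpha>\<in>Rp. w \<alpha> \<in> uminus ` Rp}"

definition weights :: "('v::real_vector \<Rightarrow> 'v \<Rightarrow> real) \<Rightarrow> 'v set \<Rightarrow> 'v set"
  where "weights B R = {lam. \<forall>\<alpha>\<in>R. B lam (coroot B \<alpha>) \<in> \<int>}"

definition dominant_weights :: "('v::real_vector \<Rightarrow> 'v \<Rightarrow> real) \<Rightarrow> 'v set \<Rightarrow> 'v set \<Rightarrow> 'v set"
  where "dominant_weights B R Rp = {lam\<in>weights B R. \<forall>\<alpha>\<in>Rp. B lam (coroot B \<alpha>) \<ge> 0}"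

definition dominance_le :: "'v::real_vector set \<Rightarrow> 'v \<Rightarrow> 'v \<Rightarrow> bool"
  where "dominance_le Rp \<mu> lam \<longleftrightarrow> (\<exists>n::'v \<Rightarrow> nat. lam - \<mu> = (\<Sum>\<alpha>\<in>Rp. real (n \<alpha>) *\<^sub>R \<alpha>))"

definition half_sum :: "'v::real_vector set \<Rightarrow> 'v"
  where "half_sum Rp = (1/2) *\<^sub>R (\<Sum>\<alpha>\<in>Rp. \<alpha>)"

definition weyl_stabilizer ::
    "('v::real_vector \<Rightarrow> 'v \<Rightarrow> real) \<Rightarrow> 'v set \<Rightarrow> 'v \<Rightarrow> ('v \<Rightarrow> 'v) set"
  where "weyl_stabilizer B R lam = {w\<in>weyl_group B R. w lam = lam}"


section \<open>Weyl characters and Macdonald spherical functions\<close>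

definition alternant ::
    "('v::real_vector \<Rightarrow> 'v \<Rightarrow> real) \<Rightarrow> 'v set \<Rightarrow> 'v set \<Rightarrow> 'v \<Rightarrow> ('v, 'c::idom) monoid_algebra fract"
  where "alternant B R Rp \<mu> = (\<Sum>w\<in>weyl_group B R. (-1) ^ weyl_length B Rp w * xpow (w \<mu>))"

definition weyl_character ::
    "('v::real_vector \<Rightarrow> 'v \<Rightarrow> real) \<Rightarrow> 'v set \<Rightarrow> 'v set \<Rightarrow> 'v \<Rightarrow> ('v, 'c::idom) monoid_algebra fract"
  where "weyl_character B R Rp \<mu> =
    alternant B R Rp (\<mu> + half_sum Rp) / alternant B R Rp (half_sum Rp)"

definition R_function ::
    "('v::real_vector \<Rightarrow> 'v \<Rightarrow> real) \<Rightarrow> 'v set \<Rightarrow> 'v set \<Rightarrow> ('v \<Rightarrow> 'c::idom) \<Rightarrow> 'v \<Rightarrow>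
      ('v, 'c) monoid_algebra fract"
  where "R_function B R Rp t lam =
    (\<Sum>w\<in>weyl_group B R. fract_act w
      (xpow lam * (\<Prod>\<alpha>\<in>Rp. (1 - scalar (t \<alpha>) * xpow (- \<alpha>)) / (1 - xpow (- \<alpha>)))))"

definition stabilizer_weight_sum ::
    "('v::real_vector \<Rightarrow> 'v \<Rightarrow> real) \<Rightarrow> 'v set \<Rightarrow> 'v set \<Rightarrow> ('v \<Rightarrow> 'c::comm_ring_1) \<Rightarrow> 'v \<Rightarrow> 'c"
  where "stabilizer_weight_sum B R Rp t lam =
    (\<Sum>w\<in>weyl_stabilizer B R lam. \<Prod>\<alpha>\<in>inversions Rp w. t \<alpha>)"

definition stabilizer_poincare ::
    "('v::real_vector \<Rightarrow> 'v \<Rightarrow> real) \<Rightarrow> 'v set \<Rightarrow> 'v set \<Rightarrow> 'c::comm_ring_1 \<Rightarrow> 'v \<Rightarrow> 'c"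
  where "stabilizer_poincare B R Rp t lam = (\<Sum>w\<in>weyl_stabilizer B R lam. t ^ weyl_length B Rp w)"

definition macdonald_spherical ::
    "('v::real_vector \<Rightarrow> 'v \<Rightarrow> real) \<Rightarrow> 'v set \<Rightarrow> 'v set \<Rightarrow> 'c::idom \<Rightarrow> 'v \<Rightarrow>
      ('v, 'c) monoid_algebra fract"
  where "macdonald_spherical B R Rp t lam =
    1 / scalar (stabilizer_poincare B R Rp t lam) *
    (\<Sum>w\<in>weyl_group B R. fract_act w
      (xpow lam * (\<Prod>\<alpha>\<in>Rp. (1 - scalar t * xpow (- \<alpha>)) / (1 - xpow (- \<alpha>)))))"

end

theory Submission
  imports Defs
begin

text \<open>
  The product \<open>\<delta>\<close> of \<open>x\<^sup>\<rho>\<close> and all \<open>1 - x\<^sup>-\<^sup>\<alpha>\<close> is alternating under \<open>W\<close>. Expanding the product of the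
  \<open>1 - t\<^sub>\<alpha> x\<^sup>-\<^sup>\<alpha>\<close> over subsets \<open>E\<close> of the positive roots writes \<open>\<delta> R\<^sub>\<lambda>\<close> as a signed sum of the terms \<open>t\<^sub>E x\<^sup>\<nu>\<close>
  with \<open>\<nu> = w(\<lambda> + \<rho> - \<Sum>E)\<close>. This is an alternating element of the group algebra, hence the
  combination of the alternants of \<open>\<mu> + \<rho>\<close>, \<open>\<mu>\<close> dominant, whose coefficients are its own coefficients
  at \<open>\<mu> + \<rho>\<close>. Now \<open>w(\<rho> - \<Sum>E) = \<rho> - \<Sum>F\<close> for another subset \<open>F\<close>, which is empty exactly if \<open>E = R(w)\<close>.
  So only \<open>\<mu> = w\<lambda> - \<Sum>F \<le> \<lambda>\<close> occur, and \<open>\<mu> = \<lambda>\<close> forces \<open>w \<in> W\<^sub>\<lambda>\<close> and \<open>E = R(w)\<close>. For \<open>\<lambda> = 0\<close> the same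
  argument shows that \<open>\<delta>\<close> is the alternant of \<open>\<rho>\<close> and that \<open>R\<^sub>0\<close> is the constant \<open>W\<^sub>0(t)\<close>. For equal
  parameters, the latter applied to the root system orthogonal to \<open>\<lambda>\<close> shows that each coset of
  \<open>W\<^sub>\<lambda>\<close> contributes a multiple of \<open>W\<^sub>\<lambda>(t)\<close> to \<open>\<delta> R\<^sub>\<lambda>\<close>, which gives (b).
\<close>

section \<open>Roots, reflections and lengths\<close>

text \<open>The roots need not span, so that the roots orthogonal to a dominant weight are an instance.\<close>

locale root_system =
  fixes B :: "'v::real_vector \<Rightarrow> 'v \<Rightarrow> real" and R :: "'v set" and f :: "'v \<Rightarrow> real"
  assumes bilinear: "bilinear B"
    and sym: "B x y = B y x"
    and pos_def: "x \<noteq> 0 \<Longrightarrow> B x x > 0"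
    and finite_roots: "finite R"
    and zero_not_root: "0 \<notin> R"
    and refl_root_closed: "\<alpha> \<in> R \<Longrightarrow> \<beta> \<in> R \<Longrightarrow> refl_root B \<alpha> \<beta> \<in> R"
    and integral: "\<alpha> \<in> R \<Longrightarrow> \<beta> \<in> R \<Longrightarrow> B \<beta> (coroot B \<alpha>) \<in> \<int>"
    and reduced: "\<alpha> \<in> R \<Longrightarrow> c *\<^sub>R \<alpha> \<in> R \<Longrightarrow> c = 1 \<or> c = -1"
    and linear_f: "linear f"
    and f_nonzero: "\<alpha> \<in> R \<Longrightarrow> f \<alpha> \<noteq> 0"
begin

definition Rp :: "'v set" where "Rp = {\<alpha>\<in>R. f \<alpha> > 0}"

abbreviation W :: "('v \<Rightarrow> 'v) set" where "W \<equiv> weyl_group B R"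
abbreviation simple :: "'v set" where "simple \<equiv> simple_roots Rp"
abbreviation rho :: 'v where "rho \<equiv> half_sum Rp"
abbreviation s :: "'v \<Rightarrow> 'v \<Rightarrow> 'v" where "s \<equiv> refl_root B"
text \<open>The body repeats the \<open>foldr\<close> inside \<open>weyl_length\<close>, so that
  minimal words and lengths unfold to one another.\<close>

definition word :: "'v list \<Rightarrow> 'v \<Rightarrow> 'v"
  where "word \<alpha>s \<equiv> foldr (\<lambda>\<alpha> g. refl_root B \<alpha> \<circ> g) \<alpha>s id"

lemmas B_simps = bilinear_ladd[OF bilinear] bilinear_radd[OF bilinear]
  bilinear_lmul[OF bilinear] bilinear_rmul[OF bilinear]
  bilinear_lneg[OF bilinear] bilinear_rneg[OF bilinear]
  bilinear_lsub[OF bilinear] bilinear_rsub[OF bilinear]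
  bilinear_lzero[OF bilinear] bilinear_rzero[OF bilinear]

lemmas f_simps = linear_add[OF linear_f] linear_diff[OF linear_f] linear_cmul[OF linear_f]
  linear_neg[OF linear_f] linear_0[OF linear_f]

section \<open>Reflections and the Weyl group as isometries permuting the roots\<close>

lemma pairing_eq: "B v (coroot B \<alpha>) = 2 * B v \<alpha> / B \<alpha> \<alpha>"
  by (simp add: coroot_def B_simps)

lemma refl_eq: "s \<alpha> v = v - (2 * B v \<alpha> / B \<alpha> \<alpha>) *\<^sub>R \<alpha>"
  by (simp add: refl_root_def pairing_eq)

lemma root_norm_pos: "\<alpha> \<in> R \<Longrightarrow> B \<alpha> \<alpha> > 0"
  by (metis pos_def zero_not_root)

lemma refl_self: "\<alpha> \<in> R \<Longrightarrow> s \<alpha> \<alpha> = - \<alpha>"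
proof -
  assume "\<alpha> \<in> R"
  then have "2 * B \<alpha> \<alpha> / B \<alpha> \<alpha> = 2" using root_norm_pos[of \<alpha>] by simp
  then show ?thesis unfolding refl_eq by (simp add: scaleR_2)
qed

lemma uminus_root: "\<alpha> \<in> R \<Longrightarrow> - \<alpha> \<in> R"
  using refl_root_closed[of \<alpha> \<alpha>] by (simp add: refl_self)

lemma uminus_root_iff: "- \<alpha> \<in> R \<longleftrightarrow> \<alpha> \<in> R"
  using uminus_root[of \<alpha>] uminus_root[of "- \<alpha>"] by auto

lemma refl_uminus: "s (- \<alpha>) = s \<alpha>"
  by (rule ext) (simp add: refl_eq B_simps)

lemma linear_refl: "linear (s \<alpha>)"
  by (rule linearI) (simp_all add: refl_eq B_simps algebra_simps add_divide_distrib)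

lemma refl_isometry: "\<alpha> \<in> R \<Longrightarrow> B (s \<alpha> x) (s \<alpha> y) = B x y"
  using root_norm_pos[of \<alpha>] sym[of \<alpha> y] sym[of \<alpha> x]
  by (simp add: refl_eq B_simps field_simps)

lemma refl_refl: "\<alpha> \<in> R \<Longrightarrow> s \<alpha> (s \<alpha> v) = v"
proof -
  assume \<alpha>: "\<alpha> \<in> R"
  have "s \<alpha> (s \<alpha> v) = s \<alpha> v - (2 * B v \<alpha> / B \<alpha> \<alpha>) *\<^sub>R s \<alpha> \<alpha>"
    by (subst (2) refl_eq) (simp add: linear_diff[OF linear_refl] linear_cmul[OF linear_refl])
  also have "\<dots> = v"
    unfolding refl_self[OF \<alpha>] by (simp add: refl_eq)
  finally show ?thesis .
qed

lemma refl_comp_refl: "\<alpha> \<in> R \<Longrightarrow> s \<alpha> \<circ> s \<alpha> = id"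
  by (auto simp: refl_refl)

lemma refl_in_W: "\<alpha> \<in> R \<Longrightarrow> s \<alpha> \<in> W"
  using weyl_group.weyl_refl[OF weyl_group.weyl_id, of \<alpha> R B] by simp

lemma W_comp: "w \<in> W \<Longrightarrow> v \<in> W \<Longrightarrow> w \<circ> v \<in> W"
  by (induction rule: weyl_group.induct) (auto simp: comp_assoc intro: weyl_group.intros)

lemma W_linear: "w \<in> W \<Longrightarrow> linear w"
proof (induction rule: weyl_group.induct)
  case weyl_id
  show ?case by (rule linear_id)
next
  case (weyl_refl w \<alpha>)
  then show ?case using linear_compose linear_refl by blast
qed

lemma W_isometry: "w \<in> W \<Longrightarrow> B (w x) (w y) = B x y"
  by (induction rule: weyl_group.induct) (auto simp: refl_isometry)

lemma W_root: "w \<in> W \<Longrightarrow> \<alpha> \<in> R \<Longrightarrow> w \<alpha> \<in> R"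
  by (induction arbitrary: \<alpha> rule: weyl_group.induct) (auto simp: refl_root_closed)

lemma W_inverse: "w \<in> W \<Longrightarrow> bij w \<and> inv w \<in> W"
proof (induction rule: weyl_group.induct)
  case weyl_id
  have "bij (id :: 'v \<Rightarrow> 'v) \<and> inv id \<in> W" by (simp add: weyl_group.weyl_id)
  then show ?case .
next
  case (weyl_refl w \<alpha>)
  have \<alpha>: "bij (s \<alpha>)" "inv (s \<alpha>) = s \<alpha>"
    using refl_comp_refl[OF weyl_refl(2)] o_bij inv_unique_comp by blast+
  have w: "bij w" "inv w \<in> W" using weyl_refl.IH by auto
  have "bij (s \<alpha> \<circ> w) \<and> inv (s \<alpha> \<circ> w) \<in> W"
    using w \<alpha> weyl_refl(2) W_comp[of "inv w" "s \<alpha>"] refl_in_W[of \<alpha>]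
    by (simp add: o_inv_distrib bij_comp)
  then show ?case .
qed

lemmas W_bij = W_inverse[THEN conjunct1] and W_inv = W_inverse[THEN conjunct2]

lemma W_inj: "w \<in> W \<Longrightarrow> inj w"
  using W_bij bij_is_inj by blast

lemma W_inv_left [simp]: "w \<in> W \<Longrightarrow> inv w (w x) = x"
  by (simp add: W_inj)

lemma W_inv_right [simp]: "w \<in> W \<Longrightarrow> w (inv w x) = x"
  using W_bij bij_is_surj surj_f_inv_f by metis

lemma W_inv_comp [simp]: "w \<in> W \<Longrightarrow> inv w \<circ> w = id" "w \<in> W \<Longrightarrow> w \<circ> inv w = id"
  by auto

lemma W_simps:
  assumes "w \<in> W"
  shows "w (x + y) = w x + w y" "w (x - y) = w x - w y" "w (- x) = - w x"
    "w (c *\<^sub>R x) = c *\<^sub>R w x" "w 0 = 0"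
  using W_linear[OF assms] by (simp_all add: linear_add linear_diff linear_neg linear_cmul linear_0)

lemma W_refl_conj:
  assumes "w \<in> W"
  shows "w \<circ> s \<alpha> = s (w \<alpha>) \<circ> w"
  using W_isometry[OF assms] by (intro ext) (simp add: refl_eq W_simps[OF assms])

section \<open>Positive and simple roots\<close>

lemma Rp_root: "\<alpha> \<in> Rp \<Longrightarrow> \<alpha> \<in> R" and Rp_pos: "\<alpha> \<in> Rp \<Longrightarrow> f \<alpha> > 0"
  by (auto simp: Rp_def)

lemma finite_Rp: "finite Rp"
  using finite_roots by (simp add: Rp_def)

lemma not_Rp_iff: "\<alpha> \<in> R \<Longrightarrow> \<alpha> \<notin> Rp \<longleftrightarrow> - \<alpha> \<in> Rp"
  using f_nonzero[of \<alpha>] by (auto simp: Rp_def f_simps uminus_root_iff)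

lemma simple_Rp: "\<alpha> \<in> simple \<Longrightarrow> \<alpha> \<in> Rp"
  by (simp add: simple_roots_def)

lemma simple_root: "\<alpha> \<in> simple \<Longrightarrow> \<alpha> \<in> R"
  using simple_Rp Rp_root by blast

text \<open>Since \<open>Rp\<close> is finite, the number of positive roots with a smaller value of
  \<open>f\<close> is a natural number that can serve as the measure.\<close>

lemma Rp_induct_f [consumes 1, case_names less]:
  assumes "\<alpha> \<in> Rp"
    and "\<And>\<alpha>. \<alpha> \<in> Rp \<Longrightarrow> (\<And>\<beta>. \<beta> \<in> Rp \<Longrightarrow> f \<beta> < f \<alpha> \<Longrightarrow> P \<beta>) \<Longrightarrow> P \<alpha>"
  shows "P \<alpha>"
  using assms(1)
proof (induction "card {\<beta>\<in>Rp. f \<beta> < f \<alpha>}" arbitrary: \<alpha> rule: less_induct)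
  case less
  show ?case
  proof (rule assms(2)[OF less.prems])
    fix \<beta> assume \<beta>: "\<beta> \<in> Rp" "f \<beta> < f \<alpha>"
    then have "{\<gamma>\<in>Rp. f \<gamma> < f \<beta>} \<subset> {\<gamma>\<in>Rp. f \<gamma> < f \<alpha>}" by force
    then have "card {\<gamma>\<in>Rp. f \<gamma> < f \<beta>} < card {\<gamma>\<in>Rp. f \<gamma> < f \<alpha>}"
      by (intro psubset_card_mono) (simp_all add: finite_Rp)
    then show "P \<beta>" using less.hyps \<beta>(1) by blast
  qed
qed

text \<open>A positive root that is not simple is by definition a sum of two positive roots, and
  \<open>f\<close> is smaller on both. This induction takes the place of coordinates with respect to
  a base.\<close>

lemma Rp_induct [consumes 1, case_names simple add]:
  assumes "\<alpha> \<in> Rp" "\<And>\<alpha>. \<alpha> \<in> simple \<Longrightarrow> P \<alpha>"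
    and "\<And>\<beta> \<gamma>. \<beta> \<in> Rp \<Longrightarrow> \<gamma> \<in> Rp \<Longrightarrow> \<beta> + \<gamma> \<in> Rp \<Longrightarrow> P \<beta> \<Longrightarrow> P \<gamma> \<Longrightarrow> P (\<beta> + \<gamma>)"
  shows "P \<alpha>"
  using assms(1)
proof (induction rule: Rp_induct_f)
  case (less \<alpha>)
  show ?case
  proof (cases "\<alpha> \<in> simple")
    case False
    then obtain \<beta> \<gamma> where *: "\<beta> \<in> Rp" "\<gamma> \<in> Rp" "\<alpha> = \<beta> + \<gamma>"
      using less.hyps by (auto simp: simple_roots_def)
    then have "f \<beta> < f \<alpha>" "f \<gamma> < f \<alpha>" using Rp_pos by (auto simp: f_simps)
    then show ?thesis using assms(3) * less by blast
  qed (use assms(2) in blast)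
qed

text \<open>If the product were positive, both pairings would be positive integers with product
  below 4, so one of them is 1 and a reflection shows that \<alpha> - \<beta> is a root. Depending
  on its sign, \<alpha> or \<beta> is a sum of two positive roots.\<close>

lemma simple_obtuse:
  assumes "\<alpha> \<in> simple" "\<beta> \<in> simple" "\<alpha> \<noteq> \<beta>"
  shows "B \<alpha> \<beta> \<le> 0"
proof (rule ccontr)
  assume "\<not> B \<alpha> \<beta> \<le> 0"
  then have pos: "B \<alpha> \<beta> > 0" by simp
  have R: "\<alpha> \<in> R" "\<beta> \<in> R" and Rp: "\<alpha> \<in> Rp" "\<beta> \<in> Rp"
    using assms simple_root simple_Rp by auto
  note n = root_norm_pos[OF R(1)] root_norm_pos[OF R(2)]
  define p where "p = B \<alpha> (coroot B \<beta>)"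
  define q where "q = B \<beta> (coroot B \<alpha>)"
  have "p \<in> \<int>" "q \<in> \<int>" using integral R by (auto simp: p_def q_def)
  then obtain m k :: int where mk: "p = of_int m" "q = of_int k" by (auto elim!: Ints_cases)
  have pq: "p > 0" "q > 0" using pos n sym[of \<alpha> \<beta>] by (auto simp: p_def q_def pairing_eq)
  have "\<alpha> \<noteq> c *\<^sub>R \<beta>" for c
  proof
    assume c: "\<alpha> = c *\<^sub>R \<beta>"
    then have "c = 1 \<or> c = -1" using reduced R by blast
    then show False using c assms(3) Rp Rp_pos[of \<alpha>] Rp_pos[of \<beta>] by (auto simp: f_simps)
  qed
  \<comment> \<open>The part of \<alpha> orthogonal to \<beta> is nonzero; its positive norm is the
    strict Cauchy-Schwarz inequality.\<close>
  then have "\<alpha> - (B \<alpha> \<beta> / B \<beta> \<beta>) *\<^sub>R \<beta> \<noteq> 0" by simp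
  from pos_def[OF this] have "B \<alpha> \<beta> * B \<alpha> \<beta> < B \<alpha> \<alpha> * B \<beta> \<beta>"
    using n sym[of \<alpha> \<beta>] by (simp add: B_simps field_simps)
  then have "p * q < 4" using n sym[of \<alpha> \<beta>] by (simp add: p_def q_def pairing_eq field_simps)
  then have "m * k < 4" using mk by (metis of_int_less_numeral_iff of_int_mult)
  moreover have "m > 0" "k > 0" using pq mk by auto
  ultimately have "m = 1 \<or> k = 1"
    using mult_mono[of 2 m 2 k] by linarith
  then have "\<alpha> - \<beta> \<in> R"
  proof
    assume "m = 1"
    then have "s \<beta> \<alpha> = \<alpha> - \<beta>" using mk p_def by (simp add: refl_root_def)
    then show ?thesis using refl_root_closed R by metis
  next
    assume "k = 1"
    then have "s \<alpha> \<beta> = \<beta> - \<alpha>" using mk q_def by (simp add: refl_root_def)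
    then show ?thesis using refl_root_closed[OF R] uminus_root_iff[of "\<alpha> - \<beta>"] by simp
  qed
  then consider "\<alpha> - \<beta> \<in> Rp" | "\<beta> - \<alpha> \<in> Rp" using not_Rp_iff[of "\<alpha> - \<beta>"] by auto
  then show False
  proof cases
    case 1
    then have "\<exists>\<gamma>\<in>Rp. \<alpha> = \<gamma> + \<beta>" by (intro bexI[of _ "\<alpha> - \<beta>"]) auto
    then show False using assms(1) Rp by (auto simp: simple_roots_def)
  next
    case 2
    then have "\<exists>\<gamma>\<in>Rp. \<beta> = \<gamma> + \<alpha>" by (intro bexI[of _ "\<beta> - \<alpha>"]) auto
    then show False using assms(2) Rp by (auto simp: simple_roots_def)
  qed
qed

text \<open>Otherwise \<beta> and \<open>- s i \<beta>\<close> are both positive, while their sum is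
  a multiple of \<open>i\<close>. Split off from each its multiple of \<open>i\<close>: the
  remainders add up to a multiple of \<open>i\<close> whose sign is forced both ways, by
  \<open>f\<close> and by the pairing with \<open>i\<close>. So they vanish, and \<beta> is
  proportional to \<open>i\<close>.\<close>

lemma simple_refl_Rp:
  assumes i: "i \<in> simple" and "\<beta> \<in> Rp" "\<beta> \<noteq> i"
  shows "s i \<beta> \<in> Rp"
proof (rule ccontr)
  assume "s i \<beta> \<notin> Rp"
  then have \<gamma>: "- s i \<beta> \<in> Rp"
    using not_Rp_iff refl_root_closed Rp_root simple_root assms by blast
  \<comment> \<open>Here \<open>v\<close> collects the simple roots other than \<open>i\<close> that
    occur in \<alpha>; they are obtuse to \<open>i\<close> and have positive
    \<open>f\<close>.\<close>
  have decomp: "\<exists>c v. \<alpha> = c *\<^sub>R i + v \<and> B v i \<le> 0 \<and> f v \<ge> 0 \<and> (f v = 0 \<longrightarrow> v = 0)"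
    if "\<alpha> \<in> Rp" for \<alpha>
    using that
  proof (induction rule: Rp_induct)
    case (simple \<alpha>)
    show ?case
    proof (cases "\<alpha> = i")
      case True
      then show ?thesis by (intro exI[of _ 1] exI[of _ 0]) (simp add: B_simps f_simps)
    next
      case False
      then show ?thesis
        using simple_obtuse[OF simple i] Rp_pos[OF simple_Rp[OF simple]]
        by (intro exI[of _ 0] exI[of _ \<alpha>]) simp
    qed
  next
    case (add \<beta> \<gamma>)
    then obtain c v d u where
      "\<beta> = c *\<^sub>R i + v \<and> B v i \<le> 0 \<and> f v \<ge> 0 \<and> (f v = 0 \<longrightarrow> v = 0)"
      "\<gamma> = d *\<^sub>R i + u \<and> B u i \<le> 0 \<and> f u \<ge> 0 \<and> (f u = 0 \<longrightarrow> u = 0)" by blast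
    then show ?case
      by (intro exI[of _ "c + d"] exI[of _ "v + u"]) (auto simp: B_simps f_simps algebra_simps)
  qed
  obtain c v where v: "\<beta> = c *\<^sub>R i + v" "B v i \<le> 0" "f v \<ge> 0" "f v = 0 \<Longrightarrow> v = 0"
    using decomp[OF assms(2)] by blast
  obtain d u where u: "- s i \<beta> = d *\<^sub>R i + u" "B u i \<le> 0" "f u \<ge> 0" "f u = 0 \<Longrightarrow> u = 0"
    using decomp[OF \<gamma>] by blast
  \<comment> \<open>Since \<beta> - \<open>s i \<beta>\<close> is the pairing times
    \<open>i\<close>, this is what is left for \<open>v + u\<close> once \<open>c\<close> and
    \<open>d\<close> are subtracted.\<close>
  define k where "k = B \<beta> (coroot B i) - c - d"
  have k: "v + u = k *\<^sub>R i"
    using v(1) u(1) by (simp add: refl_root_def k_def algebra_simps)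
  have "f i > 0" "B i i > 0" using i simple_Rp Rp_pos root_norm_pos simple_root by auto
  moreover have "k * f i \<ge> 0" "k * B i i \<le> 0"
    using arg_cong[OF k, of f] arg_cong[OF k, of "\<lambda>x. B x i"] u v by (simp_all add: f_simps B_simps)
  ultimately have "k = 0" by (simp add: zero_le_mult_iff mult_le_0_iff)
  then have "f v = 0" using arg_cong[OF k, of f] u v by (simp add: f_simps)
  then have \<beta>: "\<beta> = c *\<^sub>R i" using v by simp
  then have "c = 1 \<or> c = -1" using reduced assms(2) i simple_root Rp_root by blast
  then show False using \<beta> \<open>f i > 0\<close> assms Rp_pos[of \<beta>] by (auto simp: f_simps)
qed

section \<open>Words in simple reflections and the exchange condition\<close>

lemma word_simps [simp]: "word [] = id" "word (\<alpha> # \<alpha>s) = s \<alpha> \<circ> word \<alpha>s"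
  by (simp_all add: word_def)

lemma word_append: "word (\<alpha>s @ \<beta>s) = word \<alpha>s \<circ> word \<beta>s"
  by (induction \<alpha>s) (simp_all add: comp_assoc)

lemma word_in_W: "set \<alpha>s \<subseteq> simple \<Longrightarrow> word \<alpha>s \<in> W"
  by (induction \<alpha>s) (auto intro: weyl_group.intros simple_root)

lemma word_rev: "set \<alpha>s \<subseteq> simple \<Longrightarrow> word \<alpha>s \<circ> word (rev \<alpha>s) = id"
proof (induction \<alpha>s)
  case (Cons a \<alpha>s)
  have "word (a # \<alpha>s) \<circ> word (rev (a # \<alpha>s)) = s a \<circ> (word \<alpha>s \<circ> word (rev \<alpha>s)) \<circ> s a"
    by (simp add: word_append comp_assoc)
  also have "word \<alpha>s \<circ> word (rev \<alpha>s) = id"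
    using Cons.prems by (intro Cons.IH) simp
  also have "s a \<circ> id \<circ> s a = id" using refl_comp_refl simple_root Cons.prems by simp
  finally show ?case .
qed simp

text \<open>Applying the letters to \<alpha> from the right, some letter is the first to make it
  negative. That letter deletes itself against the added reflection, because conjugating
  \<open>s \<alpha>\<close> through the letters to its right gives the same reflection.\<close>

lemma exchange:
  assumes "set \<alpha>s \<subseteq> simple" "\<alpha> \<in> simple" "word \<alpha>s \<alpha> \<notin> Rp"
  shows "\<exists>\<beta>s. set \<beta>s \<subseteq> simple \<and> Suc (length \<beta>s) = length \<alpha>s \<and> word \<alpha>s \<circ> s \<alpha> = word \<beta>s"
  using assms
proof (induction \<alpha>s)
  case Nil
  then show ?case using simple_Rp by simp
next
  case (Cons a \<alpha>s)
  show ?case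
  proof (cases "word \<alpha>s \<alpha> \<in> Rp")
    case False
    have "set \<alpha>s \<subseteq> simple" using Cons.prems by simp
    then obtain \<beta>s where "set \<beta>s \<subseteq> simple" "Suc (length \<beta>s) = length \<alpha>s" "word \<alpha>s \<circ> s \<alpha> = word \<beta>s"
      using Cons.IH Cons.prems(2) False by blast
    then have "set (a # \<beta>s) \<subseteq> simple \<and> Suc (length (a # \<beta>s)) = length (a # \<alpha>s) \<and>
        word (a # \<alpha>s) \<circ> s \<alpha> = word (a # \<beta>s)"
      using Cons.prems by (simp add: comp_assoc)
    then show ?thesis by blast
  next
    case True
    \<comment> \<open>The only positive root that \<open>s a\<close> makes negative is
      \<open>a\<close>.\<close>
    then have "word \<alpha>s \<alpha> = a" using Cons.prems simple_refl_Rp by auto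
    then have "word \<alpha>s \<circ> s \<alpha> = s a \<circ> word \<alpha>s"
      using W_refl_conj[OF word_in_W, of \<alpha>s \<alpha>] Cons.prems by simp
    then have "word (a # \<alpha>s) \<circ> s \<alpha> = (s a \<circ> s a) \<circ> word \<alpha>s"
      by (simp add: comp_assoc)
    then have "word (a # \<alpha>s) \<circ> s \<alpha> = word \<alpha>s"
      using refl_comp_refl[of a] simple_root Cons.prems by simp
    moreover have "set \<alpha>s \<subseteq> simple" "Suc (length \<alpha>s) = length (a # \<alpha>s)" using Cons.prems by auto
    ultimately show ?thesis by blast
  qed
qed

text \<open>A positive root that is not simple has a positive product with some simple
  \<open>j\<close>, as otherwise its product with every positive root, itself included, would be at
  most 0. Reflecting in \<open>j\<close> keeps it positive and lowers \<open>f\<close>.\<close>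

lemma Rp_conj_simple:
  assumes "\<alpha> \<in> Rp"
  shows "\<exists>\<alpha>s i. set \<alpha>s \<subseteq> simple \<and> i \<in> simple \<and> \<alpha> = word \<alpha>s i"
  using assms
proof (induction rule: Rp_induct_f)
  case (less \<alpha>)
  show ?case
  proof (cases "\<alpha> \<in> simple")
    case True
    then show ?thesis by (intro exI[of _ "[]"] exI[of _ \<alpha>]) simp
  next
    case False
    have "\<exists>j\<in>simple. B \<alpha> j > 0"
    proof (rule ccontr)
      assume *: "\<not> (\<exists>j\<in>simple. B \<alpha> j > 0)"
      have "B \<alpha> \<beta> \<le> 0" if "\<beta> \<in> Rp" for \<beta>
        using that by (induction rule: Rp_induct) (use * in \<open>force simp: B_simps\<close>)+
      then show False using less.hyps root_norm_pos Rp_root by force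
    qed
    then obtain j where j: "j \<in> simple" "B \<alpha> j > 0" by blast
    have jR: "j \<in> R" "B j j > 0" "f j > 0" using j simple_root root_norm_pos simple_Rp Rp_pos by auto
    have "s j \<alpha> \<in> Rp" using simple_refl_Rp j less.hyps False by blast
    moreover have "f (s j \<alpha>) < f \<alpha>"
      using jR j by (simp add: refl_eq f_simps)
    ultimately obtain \<alpha>s i where "set \<alpha>s \<subseteq> simple" "i \<in> simple" "s j \<alpha> = word \<alpha>s i"
      using less.IH by blast
    then show ?thesis
      using j refl_refl[OF jR(1), of \<alpha>] by (intro exI[of _ "j # \<alpha>s"] exI[of _ i]) auto
  qed
qed

lemma refl_conj_simple:
  assumes "\<alpha> \<in> R"
  shows "\<exists>\<alpha>s i. set \<alpha>s \<subseteq> simple \<and> i \<in> simple \<and> s \<alpha> = word \<alpha>s \<circ> s i \<circ> word (rev \<alpha>s)"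
proof -
  have *: "\<exists>\<alpha>s i. set \<alpha>s \<subseteq> simple \<and> i \<in> simple \<and> s \<alpha> = word \<alpha>s \<circ> s i \<circ> word (rev \<alpha>s)"
    if \<alpha>: "\<alpha> \<in> Rp" for \<alpha>
  proof -
    obtain \<alpha>s i where i: "set \<alpha>s \<subseteq> simple" "i \<in> simple" "\<alpha> = word \<alpha>s i"
      using Rp_conj_simple[OF \<alpha>] by blast
    then have "word \<alpha>s \<circ> s i \<circ> word (rev \<alpha>s) = s \<alpha> \<circ> (word \<alpha>s \<circ> word (rev \<alpha>s))"
      using W_refl_conj[OF word_in_W] by (simp add: comp_assoc)
    then show ?thesis using i word_rev by (metis comp_id)
  qed
  show ?thesis
  proof (cases "\<alpha> \<in> Rp")
    case False
    then show ?thesis using *[of "- \<alpha>"] not_Rp_iff[OF assms] by (simp add: refl_uminus)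
  qed (rule *)
qed

text \<open>This reconciles \<open>weyl_group\<close>, generated by all reflections, with
  \<open>weyl_length\<close>, which speaks of simple ones: every reflection is conjugate to a simple
  one by a word.\<close>

lemma W_word:
  assumes "w \<in> W"
  shows "\<exists>\<alpha>s. set \<alpha>s \<subseteq> simple \<and> w = word \<alpha>s"
  using assms
proof (induction rule: weyl_group.induct)
  case weyl_id
  show ?case by (intro exI[of _ "[]"]) simp
next
  case (weyl_refl w \<alpha>)
  then obtain \<beta>s where \<beta>: "set \<beta>s \<subseteq> simple" "w = word \<beta>s" by blast
  obtain \<alpha>s i where "set \<alpha>s \<subseteq> simple" "i \<in> simple" "s \<alpha> = word \<alpha>s \<circ> s i \<circ> word (rev \<alpha>s)"
    using refl_conj_simple weyl_refl by blast
  then show ?case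
    using \<beta> by (intro exI[of _ "\<alpha>s @ [i] @ rev \<alpha>s @ \<beta>s"]) (simp add: word_append comp_assoc)
qed

section \<open>Length as the number of inversions\<close>

abbreviation inversions' :: "('v \<Rightarrow> 'v) \<Rightarrow> 'v set" where "inversions' \<equiv> inversions Rp"

lemma inversions_eq:
  assumes "w \<in> W"
  shows "inversions' w = {\<alpha>\<in>Rp. w \<alpha> \<notin> Rp}"
proof -
  have "w \<alpha> \<in> uminus ` Rp \<longleftrightarrow> w \<alpha> \<notin> Rp" if "\<alpha> \<in> Rp" for \<alpha>
  proof -
    have "w \<alpha> \<in> uminus ` Rp \<longleftrightarrow> - w \<alpha> \<in> Rp" by (metis image_iff minus_minus)
    then show ?thesis using not_Rp_iff[of "w \<alpha>"] W_root Rp_root assms that by blast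
  qed
  then show ?thesis by (auto simp: inversions_def)
qed

lemma finite_inversions: "finite (inversions' w)"
  using finite_Rp by (simp add: inversions_def)

text \<open>As \<open>s i\<close> permutes the positive roots other than \<open>i\<close>, it
  carries the inversions of \<open>w\<close> to those of \<open>w \<circ> s i\<close> different from
  \<open>i\<close>, and \<open>i\<close> itself is a new one.\<close>

lemma card_inversions_comp_simple:
  assumes w: "w \<in> W" and i: "i \<in> simple" and wi: "w i \<in> Rp"
  shows "card (inversions' (w \<circ> s i)) = Suc (card (inversions' w))"
proof -
  have iR: "i \<in> R" "i \<in> Rp" using i simple_root simple_Rp by auto
  have ws: "w \<circ> s i \<in> W" using W_comp refl_in_W w iR by blast
  have ni: "- i \<notin> Rp" using not_Rp_iff iR by blast
  have perm: "s i \<alpha> \<in> Rp" if "\<alpha> \<in> Rp" "\<alpha> \<noteq> i" for \<alpha> using simple_refl_Rp i that by blast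
  have "inversions' (w \<circ> s i) = insert i (s i ` inversions' w)"
  proof (rule set_eqI)
    fix \<alpha>
    have "i \<in> inversions' (w \<circ> s i)"
      using iR wi not_Rp_iff[of "w i"] W_root[OF w] Rp_root
      by (simp add: inversions_eq[OF ws] refl_self W_simps[OF w])
    moreover have "\<alpha> \<in> inversions' (w \<circ> s i) \<longleftrightarrow> \<alpha> \<in> s i ` inversions' w" if "\<alpha> \<noteq> i"
    proof -
      have "\<alpha> \<in> s i ` inversions' w \<longleftrightarrow> s i \<alpha> \<in> inversions' w"
        using refl_refl[OF iR(1)] by (metis image_iff)
      also have "\<dots> \<longleftrightarrow> \<alpha> \<in> inversions' (w \<circ> s i)"
        using perm[of \<alpha>] perm[of "s i \<alpha>"] refl_refl[OF iR(1), of \<alpha>] that ni refl_self[OF iR(1)] wi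
        by (cases "s i \<alpha> = i") (auto simp: inversions_eq[OF ws] inversions_eq[OF w])
      finally show ?thesis by simp
    qed
    ultimately show "\<alpha> \<in> inversions' (w \<circ> s i) \<longleftrightarrow> \<alpha> \<in> insert i (s i ` inversions' w)" by (cases "\<alpha> = i") simp_all
  qed
  moreover have "i \<notin> s i ` inversions' w"
    using refl_refl[OF iR(1)] refl_self[OF iR(1)] ni by (auto simp: inversions_eq[OF w]) metis
  moreover have "inj_on (s i) (inversions' w)"
    using W_inj[OF refl_in_W[OF iR(1)]] inj_on_subset by blast
  ultimately show ?thesis by (simp add: finite_inversions card_image)
qed

lemma card_inversions_comp_simple':
  assumes w: "w \<in> W" and i: "i \<in> simple" and wi: "w i \<notin> Rp"
  shows "card (inversions' w) = Suc (card (inversions' (w \<circ> s i)))"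
proof -
  have iR: "i \<in> R" using i simple_root by auto
  have "(w \<circ> s i) i \<in> Rp"
    using not_Rp_iff[of "w i"] wi W_root w iR by (simp add: refl_self W_simps)
  then have "card (inversions' (w \<circ> s i \<circ> s i)) = Suc (card (inversions' (w \<circ> s i)))"
    using card_inversions_comp_simple i W_comp refl_in_W w iR by blast
  then show ?thesis by (simp add: comp_assoc refl_comp_refl[OF iR])
qed

text \<open>Prefixes of a shortest word are shortest. A prefix must send the next letter to a
  positive root, or else \<open>exchange\<close> would shorten the word; so each letter adds exactly
  one inversion.\<close>

lemma card_inversions_minimal_word:
  assumes "set \<alpha>s \<subseteq> simple"
    and "\<And>\<beta>s. set \<beta>s \<subseteq> simple \<Longrightarrow> word \<beta>s = word \<alpha>s \<Longrightarrow> length \<alpha>s \<le> length \<beta>s"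
  shows "card (inversions' (word \<alpha>s)) = length \<alpha>s"
  using assms
proof (induction \<alpha>s rule: rev_induct)
  case Nil
  have "card (inversions' (word [])) = length []"
    using inversions_eq[OF weyl_group.weyl_id] by simp
  then show ?case .
next
  case (snoc a \<alpha>s)
  have sub: "set \<alpha>s \<subseteq> simple" "a \<in> simple" using snoc.prems by auto
  have eq: "word (\<alpha>s @ [a]) = word \<alpha>s \<circ> s a" by (simp add: word_append)
  have "length \<alpha>s \<le> length \<beta>s" if "set \<beta>s \<subseteq> simple" "word \<beta>s = word \<alpha>s" for \<beta>s
    using snoc.prems(2)[of "\<beta>s @ [a]"] that sub by (simp add: word_append)
  then have IH: "card (inversions' (word \<alpha>s)) = length \<alpha>s" using snoc.IH sub by blast
  have "word \<alpha>s a \<in> Rp"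
  proof (rule ccontr)
    assume "word \<alpha>s a \<notin> Rp"
    then obtain \<beta>s where "set \<beta>s \<subseteq> simple" "Suc (length \<beta>s) = length \<alpha>s" "word \<alpha>s \<circ> s a = word \<beta>s"
      using exchange sub by blast
    then show False using snoc.prems(2)[of \<beta>s] eq by simp
  qed
  then have "card (inversions' (word (\<alpha>s @ [a]))) = length (\<alpha>s @ [a])"
    unfolding eq using card_inversions_comp_simple[OF word_in_W] sub IH by simp
  then show ?case .
qed

lemma weyl_length_word:
  assumes "w \<in> W"
  shows "\<exists>\<alpha>s. set \<alpha>s \<subseteq> simple \<and> w = word \<alpha>s \<and> length \<alpha>s = weyl_length B Rp w \<and>
    card (inversions' w) = weyl_length B Rp w"
proof -
  let ?P = "\<lambda>n. \<exists>\<alpha>s. set \<alpha>s \<subseteq> simple \<and> length \<alpha>s = n \<and> w = word \<alpha>s"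
  have len: "weyl_length B Rp w = (LEAST n. ?P n)" by (simp add: weyl_length_def word_def)
  have "\<exists>n. ?P n" using W_word[OF assms] by blast
  then have "?P (weyl_length B Rp w)" unfolding len by (rule LeastI_ex)
  then obtain \<alpha>s where \<alpha>s: "set \<alpha>s \<subseteq> simple" "length \<alpha>s = weyl_length B Rp w" "w = word \<alpha>s" by blast
  moreover have "length \<alpha>s \<le> length \<beta>s" if "set \<beta>s \<subseteq> simple" "word \<beta>s = word \<alpha>s" for \<beta>s
    unfolding \<alpha>s(2) len using that \<alpha>s(3) by (intro Least_le) auto
  ultimately show ?thesis using card_inversions_minimal_word by metis
qed

lemma weyl_length_eq: "w \<in> W \<Longrightarrow> weyl_length B Rp w = card (inversions' w)"
  using weyl_length_word by metis

lemma inversions_empty: "w \<in> W \<Longrightarrow> inversions' w = {} \<Longrightarrow> w = id"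
  using weyl_length_word[of w] by force

lemma inversions_id: "inversions' id = {}"
  using inversions_eq[OF weyl_group.weyl_id] by auto

lemma inversion_simple:
  assumes "w \<in> W" "inversions' w \<noteq> {}"
  shows "\<exists>i\<in>simple. w i \<notin> Rp"
proof (rule ccontr)
  assume *: "\<not> (\<exists>i\<in>simple. w i \<notin> Rp)"
  have "w \<beta> \<in> Rp" if "\<beta> \<in> Rp" for \<beta>
    using that
  proof (induction rule: Rp_induct)
    case (add \<beta> \<gamma>)
    then show ?case
      using W_root[OF assms(1) Rp_root, of "\<beta> + \<gamma>"]
      by (simp add: Rp_def W_simps[OF assms(1)] f_simps)
  qed (use * in blast)
  then show False using assms by (auto simp: inversions_eq)
qed

text \<open>An element with an inversion makes some simple root negative, and splitting off that
  reflection on the right removes one inversion. The condition \<open>w i \<in> Rp\<close> records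
  that each step goes up in length.\<close>

lemma W_induct [consumes 1, case_names id comp]:
  assumes "w \<in> W" "P id"
    and "\<And>w i. w \<in> W \<Longrightarrow> i \<in> simple \<Longrightarrow> w i \<in> Rp \<Longrightarrow> P w \<Longrightarrow> P (w \<circ> s i)"
  shows "P w"
  using assms(1)
proof (induction "card (inversions' w)" arbitrary: w rule: less_induct)
  case less
  show ?case
  proof (cases "inversions' w = {}")
    case True
    then show ?thesis using inversions_empty less.prems assms(2) by blast
  next
    case False
    then obtain i where i: "i \<in> simple" "w i \<notin> Rp" using inversion_simple less.prems by blast
    then have iR: "i \<in> R" using simple_root by blast
    let ?w = "w \<circ> s i"
    have w': "?w \<in> W" using W_comp refl_in_W less.prems iR by blast
    have "card (inversions' ?w) < card (inversions' w)"
      using card_inversions_comp_simple'[OF less.prems i] by simp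
    then have "P ?w" using less.hyps w' by blast
    moreover have "?w i \<in> Rp"
      using not_Rp_iff[of "w i"] i W_root less.prems iR by (simp add: refl_self W_simps)
    ultimately have "P (?w \<circ> s i)" using assms(3) w' i by blast
    then show ?thesis by (simp add: comp_assoc refl_comp_refl[OF iR])
  qed
qed

text \<open>If the inversions of \<open>w\<close> and \<open>v\<close> agree,
  \<open>w \<circ> inv v\<close> has none and is the identity. This embeds \<open>W\<close> into the
  power set of \<open>Rp\<close>, which is how \<open>W\<close> is seen to be finite.\<close>

lemma inj_on_inversions: "inj_on inversions' W"
proof (rule inj_onI)
  fix w v assume wv: "w \<in> W" "v \<in> W" "inversions' w = inversions' v"
  then have iv: "inv v \<in> W" using W_inv by blast
  have c: "w \<circ> inv v \<in> W" using W_comp wv iv by blast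
  have eq: "w \<alpha> \<in> Rp \<longleftrightarrow> v \<alpha> \<in> Rp" if "\<alpha> \<in> Rp" for \<alpha>
    using wv(3) that unfolding inversions_eq[OF wv(1)] inversions_eq[OF wv(2)] by blast
  have "w (inv v \<beta>) \<in> Rp" if \<beta>: "\<beta> \<in> Rp" for \<beta>
  proof (cases "inv v \<beta> \<in> Rp")
    case True
    then show ?thesis using eq wv \<beta> by simp
  next
    case False
    have R: "inv v \<beta> \<in> R" using W_root iv \<beta> Rp_root by blast
    then have n: "- inv v \<beta> \<in> Rp" using False not_Rp_iff by blast
    have "v (- inv v \<beta>) = - \<beta>" using wv by (simp add: W_simps)
    then have "v (- inv v \<beta>) \<notin> Rp" using \<beta> not_Rp_iff[of \<beta>] Rp_root uminus_root[of \<beta>] not_Rp_iff[of "- \<beta>"] by auto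
    then have "w (- inv v \<beta>) \<notin> Rp" using eq n by blast
    then show ?thesis
      using not_Rp_iff[of "w (inv v \<beta>)"] W_root wv R by (auto simp: W_simps)
  qed
  then have "inversions' (w \<circ> inv v) = {}" using c by (auto simp: inversions_eq)
  then have "w \<circ> inv v = id" using inversions_empty c by blast
  then have "w \<circ> inv v \<circ> v = v" by simp
  then show "w = v" using wv by (simp add: comp_assoc)
qed

lemma finite_W: "finite W"
proof (rule finite_imageD[OF _ inj_on_inversions])
  show "finite (inversions' ` W)"
    by (rule finite_subset[of _ "Pow Rp"]) (auto simp: inversions_def finite_Rp)
qed

subsection \<open>Dominance and half sums of orientations\<close>

text \<open>The values lie in the coefficient ring, so that signs can be coefficients of monomials.
  By \<open>weyl_length_eq\<close> this is the sign used in \<open>alternant\<close>.\<close>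

definition sg :: "('v \<Rightarrow> 'v) \<Rightarrow> 'c::comm_ring_1"
  where "sg w = (-1) ^ card (inversions' w)"

lemma sg_id [simp]: "sg id = 1"
  by (simp add: sg_def inversions_id)

lemma sg_comp_simple:
  assumes "w \<in> W" "i \<in> simple"
  shows "sg (w \<circ> s i) = - sg w"
  using card_inversions_comp_simple[OF assms] card_inversions_comp_simple'[OF assms]
  by (cases "w i \<in> Rp") (simp_all add: sg_def)

lemma sg_simple: "i \<in> simple \<Longrightarrow> sg (s i) = -1"
  using sg_comp_simple[OF weyl_group.weyl_id, of i] by simp

lemma sg_comp:
  assumes "w \<in> W" "v \<in> W"
  shows "(sg (w \<circ> v) :: 'c::comm_ring_1) = sg w * sg v"
  using assms(2)
proof (induction rule: W_induct)
  case id
  have "(sg (w \<circ> id) :: 'c) = sg w * sg id" by simp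
  then show ?case .
next
  case (comp v i)
  have "(sg (w \<circ> (v \<circ> s i)) :: 'c) = sg (w \<circ> v \<circ> s i)" by (simp only: comp_assoc)
  also have "\<dots> = - sg (w \<circ> v)" using sg_comp_simple W_comp assms(1) comp by blast
  also have "(sg (w \<circ> v) :: 'c) = sg w * sg v" by (rule comp.IH)
  also have "- (sg w * sg v :: 'c) = sg w * sg (v \<circ> s i)" using comp by (simp add: sg_comp_simple)
  finally show ?case .
qed

lemma sg_square [simp]: "sg w * sg w = 1"
  by (simp add: sg_def flip: power_mult_distrib)

text \<open>The reflection is conjugate to a simple one and the signs of the conjugating words
  cancel. It is wanted for all roots because coefficients on every reflecting hyperplane have to
  vanish.\<close>

lemma sg_refl:
  assumes "\<alpha> \<in> R"
  shows "sg (s \<alpha>) = -1"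
proof -
  obtain \<alpha>s i where i: "set \<alpha>s \<subseteq> simple" "i \<in> simple" "s \<alpha> = word \<alpha>s \<circ> s i \<circ> word (rev \<alpha>s)"
    using refl_conj_simple[OF assms] by blast
  have W: "word \<alpha>s \<in> W" "s i \<in> W" "word (rev \<alpha>s) \<in> W"
    using i word_in_W refl_in_W simple_root by auto
  have "sg (s \<alpha>) = sg (word \<alpha>s) * sg (s i) * sg (word (rev \<alpha>s))"
    unfolding i(3) by (simp add: sg_comp W W_comp)
  also have "\<dots> = - (sg (word \<alpha>s) * sg (word (rev \<alpha>s)))" by (simp add: sg_simple i)
  also have "sg (word \<alpha>s) * sg (word (rev \<alpha>s)) = sg (word \<alpha>s \<circ> word (rev \<alpha>s))"
    by (simp add: sg_comp W)
  also have "\<dots> = 1" using word_rev[OF i(1)] by simp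
  finally show ?thesis .
qed

section \<open>The cone of sums of positive roots\<close>

definition root_cone :: "'v set"
  where "root_cone = {v. \<exists>n::'v \<Rightarrow> nat. v = (\<Sum>\<alpha>\<in>Rp. real (n \<alpha>) *\<^sub>R \<alpha>)}"

lemma dominance_le_iff: "dominance_le Rp \<mu> lam \<longleftrightarrow> lam - \<mu> \<in> root_cone"
  by (simp add: dominance_le_def root_cone_def)

lemma root_cone_add: "x \<in> root_cone \<Longrightarrow> y \<in> root_cone \<Longrightarrow> x + y \<in> root_cone"
proof -
  assume "x \<in> root_cone" "y \<in> root_cone"
  then obtain m n :: "'v \<Rightarrow> nat" where
    "x = (\<Sum>\<alpha>\<in>Rp. real (m \<alpha>) *\<^sub>R \<alpha>)" "y = (\<Sum>\<alpha>\<in>Rp. real (n \<alpha>) *\<^sub>R \<alpha>)"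
    by (auto simp: root_cone_def)
  then have "x + y = (\<Sum>\<alpha>\<in>Rp. real (m \<alpha> + n \<alpha>) *\<^sub>R \<alpha>)"
    by (simp add: sum.distrib scaleR_add_left)
  then show ?thesis unfolding root_cone_def by (intro CollectI exI[of _ "\<lambda>\<alpha>. m \<alpha> + n \<alpha>"])
qed

lemma root_cone_zero: "0 \<in> root_cone"
  unfolding root_cone_def by (intro CollectI exI[of _ "\<lambda>_. 0"]) simp

lemma root_cone_multiple: "\<alpha> \<in> Rp \<Longrightarrow> real n *\<^sub>R \<alpha> \<in> root_cone"
  unfolding root_cone_def
  by (intro CollectI exI[of _ "\<lambda>\<beta>. if \<beta> = \<alpha> then n else 0"])
    (simp add: finite_Rp if_distrib[of "\<lambda>k. real k *\<^sub>R _"] sum.delta' cong: if_cong)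

lemma root_cone_sum: "finite E \<Longrightarrow> E \<subseteq> Rp \<Longrightarrow> \<Sum>E \<in> root_cone"
proof (induction rule: finite_induct)
  case (insert \<alpha> E)
  then show ?case using root_cone_multiple[of \<alpha> 1] by (simp add: root_cone_add)
qed (simp add: root_cone_zero)

lemma root_cone_induct [consumes 1, case_names zero add]:
  assumes "v \<in> root_cone" "P 0" "\<And>v \<alpha>. v \<in> root_cone \<Longrightarrow> \<alpha> \<in> Rp \<Longrightarrow> P v \<Longrightarrow> P (v + \<alpha>)"
  shows "P v"
proof -
  obtain n :: "'v \<Rightarrow> nat" where n: "v = (\<Sum>\<alpha>\<in>Rp. real (n \<alpha>) *\<^sub>R \<alpha>)"
    using assms(1) by (auto simp: root_cone_def)
  have mult: "P (v + real k *\<^sub>R \<alpha>)" if "v \<in> root_cone" "P v" "\<alpha> \<in> Rp" for v \<alpha> k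
  proof (induction k)
    case (Suc k)
    have "P (v + real k *\<^sub>R \<alpha> + \<alpha>)"
      using assms(3) Suc root_cone_add[OF that(1) root_cone_multiple] that by blast
    then show ?case by (simp add: algebra_simps)
  qed (simp add: that)
  have "(\<Sum>\<alpha>\<in>E. real (n \<alpha>) *\<^sub>R \<alpha>) \<in> root_cone \<and> P (\<Sum>\<alpha>\<in>E. real (n \<alpha>) *\<^sub>R \<alpha>)"
    if "finite E" "E \<subseteq> Rp" for E
    using that
  proof (induction rule: finite_induct)
    case (insert \<alpha> E)
    then have "real (n \<alpha>) *\<^sub>R \<alpha> + (\<Sum>\<alpha>\<in>E. real (n \<alpha>) *\<^sub>R \<alpha>) \<in> root_cone"
      using root_cone_add root_cone_multiple by blast
    moreover have "P ((\<Sum>\<alpha>\<in>E. real (n \<alpha>) *\<^sub>R \<alpha>) + real (n \<alpha>) *\<^sub>R \<alpha>)"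
      using mult insert by blast
    ultimately show ?case using insert.hyps by (simp add: add.commute)
  qed (simp add: assms(2) root_cone_zero)
  then show ?thesis using n finite_Rp by blast
qed

lemma root_cone_f: "v \<in> root_cone \<Longrightarrow> f v \<ge> 0 \<and> (f v = 0 \<longrightarrow> v = 0)"
proof (induction rule: root_cone_induct)
  case (add v \<alpha>)
  then show ?case using Rp_pos[of \<alpha>] by (simp add: f_simps)
qed (simp add: f_simps)

text \<open>The functional \<open>f\<close> is positive on the nonzero elements, so the cone is
  pointed. Every uniqueness argument for leading terms comes down to this.\<close>

lemma root_cone_add_eq_0:
  assumes "x \<in> root_cone" "y \<in> root_cone" "x + y = 0"
  shows "x = 0" "y = 0"
proof -
  have "f x + f y = 0" using assms(3) by (metis linear_add linear_0 linear_f)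
  then show "x = 0" "y = 0" using root_cone_f[OF assms(1)] root_cone_f[OF assms(2)] by auto
qed

lemma root_cone_sum_eq_0:
  assumes "E \<subseteq> Rp" "\<Sum>E = 0"
  shows "E = {}"
proof -
  have E: "finite E" using assms(1) finite_Rp finite_subset by blast
  have "(\<Sum>\<alpha>\<in>E. f \<alpha>) = 0"
    using arg_cong[OF assms(2), of f] by (simp add: linear_sum[OF linear_f] f_simps)
  then have "\<forall>\<alpha>\<in>E. f \<alpha> = 0"
    using E assms(1) Rp_pos by (subst (asm) sum_nonneg_eq_0_iff) (auto intro: less_imp_le)
  then show ?thesis using assms(1) Rp_pos by force
qed

section \<open>Weights, dominance and chambers\<close>

abbreviation weight :: "'v set" where "weight \<equiv> weights B R"
abbreviation dominant :: "'v set" where "dominant \<equiv> dominant_weights B R Rp"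

lemma pairing_sign:
  assumes "\<alpha> \<in> R"
  shows "B v (coroot B \<alpha>) \<ge> 0 \<longleftrightarrow> B v \<alpha> \<ge> 0" "B v (coroot B \<alpha>) > 0 \<longleftrightarrow> B v \<alpha> > 0"
  using root_norm_pos[OF assms] by (simp_all add: pairing_eq zero_le_divide_iff zero_less_divide_iff)

lemma weight_add: "x \<in> weight \<Longrightarrow> y \<in> weight \<Longrightarrow> x + y \<in> weight"
  by (auto simp: weights_def B_simps)

lemma weight_diff: "x \<in> weight \<Longrightarrow> y \<in> weight \<Longrightarrow> x - y \<in> weight"
  by (auto simp: weights_def B_simps)

lemma root_weight: "\<alpha> \<in> R \<Longrightarrow> \<alpha> \<in> weight"
  using integral by (auto simp: weights_def)

lemma root_cone_weight: "v \<in> root_cone \<Longrightarrow> v \<in> weight"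
proof (induction rule: root_cone_induct)
  case zero
  show ?case by (simp add: weights_def B_simps)
next
  case (add v \<alpha>)
  then show ?case using weight_add root_weight Rp_root by blast
qed

lemma dominant_iff: "\<mu> \<in> dominant \<longleftrightarrow> \<mu> \<in> weight \<and> (\<forall>\<alpha>\<in>Rp. B \<mu> \<alpha> \<ge> 0)"
  using pairing_sign(1)[OF Rp_root] by (auto simp: dominant_weights_def)

text \<open>A dominant weight has nonnegative product with the cone, so here its own norm is at most
  0. Thus 0 is the only dominant weight below 0.\<close>

lemma dominant_root_cone_eq_0:
  assumes "\<mu> \<in> dominant" "- \<mu> \<in> root_cone"
  shows "\<mu> = 0"
proof -
  have "B \<mu> v \<ge> 0" if "v \<in> root_cone" for v
    using that
    by (induction rule: root_cone_induct) (use assms(1) in \<open>auto simp: dominant_iff B_simps\<close>)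
  from this[OF assms(2)] have "B \<mu> \<mu> \<le> 0" by (simp add: B_simps)
  then show ?thesis using pos_def[of \<mu>] by force
qed

text \<open>One step of \<open>W_induct\<close>: appending \<open>s i\<close> moves the image of
  \<open>lam\<close> down by a natural multiple of the positive root \<open>w i\<close>.\<close>

lemma dominant_diff_comp_simple:
  assumes "lam \<in> dominant" "w \<in> W" "i \<in> simple" "w i \<in> Rp"
  obtains k :: nat where "real k = B lam (coroot B i)"
    "lam - (w \<circ> s i) lam = (lam - w lam) + real k *\<^sub>R w i"
proof -
  have i: "i \<in> Rp" "i \<in> R" using assms(3) simple_Rp simple_root by auto
  have "B lam (coroot B i) \<in> \<int>" "B lam (coroot B i) \<ge> 0"
    using assms(1) i by (auto simp: dominant_weights_def weights_def)
  then obtain k :: nat where k: "B lam (coroot B i) = real k"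
    by (metis Nats_cases Nats_altdef2 mem_Collect_eq)
  show thesis
    by (rule that[of k]) (simp_all add: k refl_root_def W_simps[OF assms(2)])
qed

lemma dominant_diff_root_cone:
  assumes "lam \<in> dominant" "w \<in> W"
  shows "lam - w lam \<in> root_cone"
  using assms(2)
proof (induction rule: W_induct)
  case (comp w i)
  then obtain k where "lam - (w \<circ> s i) lam = (lam - w lam) + real k *\<^sub>R w i"
    using dominant_diff_comp_simple assms(1) by blast
  then show ?case using comp root_cone_add root_cone_multiple by metis
qed (simp add: root_cone_zero)

text \<open>The stabilizer is generated by the reflections in roots orthogonal to
  \<open>lam\<close>. Along \<open>W_induct\<close> the image of \<open>lam\<close> only descends,
  so if it ends at \<open>lam\<close> no step moves it; then \<open>w i\<close> is orthogonal to
  \<open>lam\<close>, and \<open>w \<circ> s i\<close> is \<open>s (w i) \<circ> w\<close>.\<close>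

lemma dominant_stabilizer:
  assumes "lam \<in> dominant" "w \<in> W" "w lam = lam"
  shows "w \<in> weyl_group B {\<alpha>\<in>R. B lam \<alpha> = 0}"
  using assms(2,3)
proof (induction rule: W_induct)
  case id
  show ?case by (rule weyl_group.weyl_id)
next
  case (comp w i)
  have i: "i \<in> R" using comp simple_root by blast
  obtain k where k: "real k = B lam (coroot B i)"
      "lam - (w \<circ> s i) lam = (lam - w lam) + real k *\<^sub>R w i"
    using dominant_diff_comp_simple[OF assms(1) comp.hyps] by blast
  have "(lam - w lam) + real k *\<^sub>R w i = lam - (w \<circ> s i) lam" using k(2) by simp
  also have "\<dots> = 0" using comp.prems by simp
  finally have 0: "(lam - w lam) + real k *\<^sub>R w i = 0" .
  have "lam - w lam = 0" "real k *\<^sub>R w i = 0"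
    using root_cone_add_eq_0[OF _ _ 0] dominant_diff_root_cone[OF assms(1) comp.hyps(1)]
      root_cone_multiple[OF comp.hyps(3)] by blast+
  then have w: "w lam = lam" and "k = 0" using comp Rp_pos[of "w i"] by (auto simp: f_simps)
  then have li: "B lam i = 0" using k(1) root_norm_pos[OF i] by (simp add: pairing_eq)
  have "w \<circ> s i = s (w i) \<circ> w" using W_refl_conj comp by blast
  moreover have "B lam (w i) = 0" using W_isometry[OF comp.hyps(1), of lam i] w li by simp
  moreover have "s (w i) \<circ> w \<in> weyl_group B {\<alpha>\<in>R. B lam \<alpha> = 0}"
    using comp.IH[OF w] calculation(2) Rp_root[OF comp.hyps(3)] by (intro weyl_group.weyl_refl) simp_all
  ultimately have "w \<circ> s i \<in> weyl_group B {\<alpha>\<in>R. B lam \<alpha> = 0}" by simp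
  then show ?case .
qed

text \<open>Take \<open>w\<close> with \<open>f (w v)\<close> maximal over the finite group.
  Reflecting in a positive root subtracts the pairing times that root, which would raise
  \<open>f\<close> if the pairing were negative.\<close>

lemma exists_dominant_conj:
  "\<exists>w\<in>W. \<forall>\<alpha>\<in>Rp. B (w v) \<alpha> \<ge> 0"
proof -
  let ?F = "(\<lambda>w. f (w v)) ` W"
  have "finite ?F" "?F \<noteq> {}" using finite_W weyl_group.weyl_id by auto
  then have m: "Max ?F \<in> ?F" "\<And>x. x \<in> ?F \<Longrightarrow> x \<le> Max ?F" by auto
  then obtain w where w0: "w \<in> W" "Max ?F = f (w v)" by blast
  then have w: "w \<in> W" "\<And>u. u \<in> W \<Longrightarrow> f (u v) \<le> f (w v)" using m(2) by auto
  have "B (w v) \<alpha> \<ge> 0" if \<alpha>: "\<alpha> \<in> Rp" for \<alpha>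
  proof -
    have "s \<alpha> \<circ> w \<in> W" using weyl_group.weyl_refl w Rp_root \<alpha> by blast
    then have "f (s \<alpha> (w v)) \<le> f (w v)" using w(2) by fastforce
    then have "0 \<le> B (w v) (coroot B \<alpha>) * f \<alpha>" by (simp add: refl_root_def f_simps)
    then show ?thesis
      using Rp_pos[OF \<alpha>] pairing_sign(1)[OF Rp_root[OF \<alpha>], of "w v"] by (simp add: zero_le_mult_iff)
  qed
  then show ?thesis using w by blast
qed

lemma strictly_dominant_unique:
  assumes "w \<in> W" "\<And>\<alpha>. \<alpha> \<in> Rp \<Longrightarrow> B x \<alpha> > 0" "\<And>\<alpha>. \<alpha> \<in> Rp \<Longrightarrow> B (w x) \<alpha> > 0"
  shows "w = id"
proof -
  have "w \<alpha> \<in> Rp" if \<alpha>: "\<alpha> \<in> Rp" for \<alpha>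
  proof (rule ccontr)
    assume "w \<alpha> \<notin> Rp"
    then have "- w \<alpha> \<in> Rp" using not_Rp_iff W_root assms(1) Rp_root \<alpha> by blast
    then have "B (w x) (- w \<alpha>) > 0" using assms(3) by blast
    then show False using assms(2)[OF \<alpha>] W_isometry[OF assms(1)] by (simp add: B_simps)
  qed
  then have "inversions' w = {}" using assms(1) by (auto simp: inversions_eq)
  then show ?thesis using inversions_empty assms(1) by blast
qed

section \<open>Half sums of orientations\<close>

text \<open>One root is chosen from each pair of opposite roots. \<open>W\<close> permutes these
  choices, and their half sums are the vectors \<open>rho\<close> minus a sum of distinct positive
  roots.\<close>

definition orientation :: "'v set \<Rightarrow> bool"
  where "orientation S \<longleftrightarrow> S \<subseteq> R \<and> (\<forall>\<alpha>\<in>R. \<alpha> \<in> S \<longleftrightarrow> - \<alpha> \<notin> S)"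

text \<open>Replacing a positive root by its negative lowers the sum by twice the root, hence the
  half sum by the root.\<close>

lemma half_sum_orientation:
  assumes "orientation S"
  shows "half_sum S = rho - \<Sum>(Rp - S)"
proof -
  have S: "S = (Rp \<inter> S) \<union> uminus ` (Rp - S)"
  proof (intro set_eqI iffI)
    fix \<alpha> assume \<alpha>: "\<alpha> \<in> S"
    then have "\<alpha> \<in> R" "- \<alpha> \<notin> S" using assms by (auto simp: orientation_def)
    then show "\<alpha> \<in> (Rp \<inter> S) \<union> uminus ` (Rp - S)"
      using \<alpha> not_Rp_iff by (metis DiffI IntI UnI1 UnI2 imageI minus_minus)
  next
    fix \<alpha> assume "\<alpha> \<in> (Rp \<inter> S) \<union> uminus ` (Rp - S)"
    then show "\<alpha> \<in> S" using assms Rp_root by (auto simp: orientation_def)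
  qed
  have disj: "(Rp \<inter> S) \<inter> uminus ` (Rp - S) = {}"
    using not_Rp_iff Rp_root by fastforce
  have "\<Sum>S = \<Sum>(Rp \<inter> S) + \<Sum>(uminus ` (Rp - S))"
    by (subst S, rule sum.union_disjoint) (use finite_Rp disj in auto)
  also have "\<Sum>(uminus ` (Rp - S)) = - \<Sum>(Rp - S)"
    by (subst sum.reindex) (auto simp: sum_negf)
  also have "\<Sum>(Rp \<inter> S) = \<Sum>Rp - \<Sum>(Rp - S)"
    using sum.Int_Diff[OF finite_Rp, of "\<lambda>x. x" S] by simp
  finally have "\<Sum>S = \<Sum>Rp - 2 *\<^sub>R \<Sum>(Rp - S)" by (simp add: scaleR_2)
  then show ?thesis by (simp add: half_sum_def scaleR_diff_right)
qed

lemma W_image_iff: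
  assumes "w \<in> W"
  shows "\<alpha> \<in> w ` S \<longleftrightarrow> inv w \<alpha> \<in> S"
proof
  assume "inv w \<alpha> \<in> S"
  then have "w (inv w \<alpha>) \<in> w ` S" by blast
  then show "\<alpha> \<in> w ` S" using assms by simp
qed (use assms in auto)

lemma orientation_image:
  assumes "orientation S" "w \<in> W"
  shows "orientation (w ` S)"
proof -
  have "w ` S \<subseteq> R" using assms W_root by (auto simp: orientation_def)
  moreover have "inv w (- \<alpha>) = - inv w \<alpha>" for \<alpha>
    using W_simps(3) W_inv assms(2) by blast
  ultimately show ?thesis
    using assms W_root[OF W_inv[OF assms(2)]] W_image_iff[OF assms(2)] by (simp add: orientation_def)
qed

lemma half_sum_image:
  assumes "w \<in> W"
  shows "w (half_sum S) = half_sum (w ` S)"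
proof -
  have "w (\<Sum>S) = \<Sum>(w ` S)"
    using sum.reindex[of w S "\<lambda>x. x"] W_inj[OF assms] linear_sum[OF W_linear[OF assms], of "\<lambda>x. x" S]
    by (simp add: inj_on_subset[OF _ subset_UNIV])
  then show ?thesis by (simp add: half_sum_def W_simps[OF assms])
qed

text \<open>The vector \<open>rho - \<Sum>E\<close> is the half sum of the orientation in which the
  roots of \<open>E\<close> are flipped. Its image under \<open>w\<close> is again an orientation,
  with \<open>F\<close> the set of its flipped roots; nothing is flipped exactly if \<open>E\<close>
  consists of the roots that \<open>w\<close> makes negative.\<close>

lemma W_half_sum_diff:
  assumes w: "w \<in> W" and E: "E \<subseteq> Rp"
  obtains F where "F \<subseteq> Rp" "w (rho - \<Sum>E) = rho - \<Sum>F" "F = {} \<longleftrightarrow> E = inversions' w"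
    "E = {} \<Longrightarrow> F = {\<beta>\<in>Rp. inv w \<beta> \<notin> Rp}"
proof -
  let ?S = "(Rp - E) \<union> uminus ` E"
  have n: "\<alpha> \<in> Rp \<Longrightarrow> - \<alpha> \<notin> Rp" for \<alpha> using not_Rp_iff Rp_root by blast
  have S1: "\<alpha> \<in> ?S \<longleftrightarrow> \<alpha> \<notin> E" "- \<alpha> \<in> ?S \<longleftrightarrow> \<alpha> \<in> E" if "\<alpha> \<in> Rp" for \<alpha>
    using n that E by (auto simp: image_iff)
  have or: "orientation ?S"
    unfolding orientation_def
  proof (intro conjI ballI)
    show "?S \<subseteq> R" using E Rp_root uminus_root by auto
    fix \<alpha> assume "\<alpha> \<in> R"
    then consider "\<alpha> \<in> Rp" | "- \<alpha> \<in> Rp" using not_Rp_iff by blast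
    then show "\<alpha> \<in> ?S \<longleftrightarrow> - \<alpha> \<notin> ?S"
      using S1[of \<alpha>] S1[of "- \<alpha>"] by cases auto
  qed
  let ?F = "Rp - w ` ?S"
  note mem = W_image_iff[OF w, of _ ?S]
  have "Rp - ?S = E" using S1(1) E by blast
  then have "w (rho - \<Sum>E) = w (half_sum ?S)"
    by (simp only: half_sum_orientation[OF or])
  also have "\<dots> = rho - \<Sum>?F"
    by (simp only: half_sum_image[OF w] half_sum_orientation[OF orientation_image[OF or w]])
  finally have "w (rho - \<Sum>E) = rho - \<Sum>?F" .
  moreover have "?F = {} \<longleftrightarrow> E = inversions' w"
  proof
    assume F: "?F = {}"
    have "w \<alpha> \<notin> Rp" if "\<alpha> \<in> E" for \<alpha>
    proof
      assume "w \<alpha> \<in> Rp"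
      then have "inv w (w \<alpha>) \<in> ?S" using F mem by blast
      then show False using S1(1)[of \<alpha>] that E w by auto
    qed
    moreover have "w \<alpha> \<in> Rp" if "\<alpha> \<in> Rp" "\<alpha> \<notin> E" for \<alpha>
    proof (rule ccontr)
      assume "w \<alpha> \<notin> Rp"
      then have "- w \<alpha> \<in> Rp" using not_Rp_iff W_root w Rp_root that by blast
      then have "inv w (- w \<alpha>) \<in> ?S" using F mem by blast
      then have "- \<alpha> \<in> ?S" using w W_simps(3)[OF W_inv[OF w]] by simp
      then show False using S1(2) that by blast
    qed
    ultimately show "E = inversions' w" using E by (auto simp: inversions_eq[OF w])
  next
    assume E: "E = inversions' w"
    have "inv w \<beta> \<in> ?S" if \<beta>: "\<beta> \<in> Rp" for \<beta>
    proof (cases "inv w \<beta> \<in> Rp")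
      case True
      then show ?thesis using E \<beta> w by (auto simp: inversions_eq)
    next
      case False
      then have m: "- inv w \<beta> \<in> Rp" using not_Rp_iff W_root W_inv w Rp_root \<beta> by blast
      moreover have "w (- inv w \<beta>) \<notin> Rp" using n[OF \<beta>] w by (simp add: W_simps)
      ultimately have "- inv w \<beta> \<in> E" using E by (simp add: inversions_eq[OF w])
      then show ?thesis using S1(2)[OF m] by simp
    qed
    then show "?F = {}" using mem by blast
  qed
  moreover have "?F = {\<beta>\<in>Rp. inv w \<beta> \<notin> Rp}" if "E = {}"
    using mem that by auto
  ultimately show thesis using that[of ?F] by blast
qed

lemma simple_refl_rho:
  assumes "i \<in> simple"
  shows "s i rho = rho - i"
proof -
  have i: "i \<in> R" "i \<in> Rp" using assms simple_root simple_Rp by auto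
  have W: "s i \<in> W" using refl_in_W i by blast
  obtain F where F: "s i (rho - \<Sum>{}) = rho - \<Sum>F" "F = {\<beta>\<in>Rp. inv (s i) \<beta> \<notin> Rp}"
    using W_half_sum_diff[OF W, of "{}"] by blast
  have "inv (s i) = s i" using refl_comp_refl[OF i(1)] inv_unique_comp by blast
  moreover have "- i \<notin> Rp" using not_Rp_iff i by blast
  ultimately have "F = {i}"
    using F(2) simple_refl_Rp[OF assms] i by (auto simp: refl_self)
  then show ?thesis using F(1) by simp
qed

lemma rho_pairing_simple:
  assumes "i \<in> simple"
  shows "B rho (coroot B i) = 1"
proof -
  have i: "i \<noteq> 0" using assms simple_root zero_not_root by blast
  have "(B rho (coroot B i) - 1) *\<^sub>R i = 0"
    using simple_refl_rho[OF assms] by (simp add: refl_root_def scaleR_diff_left)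
  then show ?thesis using i by simp
qed

lemma strictly_dominant_rho_add:
  assumes "\<mu> \<in> dominant" "\<alpha> \<in> Rp"
  shows "B (\<mu> + rho) \<alpha> > 0"
proof -
  have "B rho \<alpha> > 0"
    using assms(2)
  proof (induction rule: Rp_induct)
    case (simple i)
    then show ?case
      using rho_pairing_simple[OF simple] pairing_sign(2)[OF simple_root[OF simple], of rho] by simp
  qed (simp add: B_simps)
  then show ?thesis using assms by (simp add: dominant_iff B_simps add_nonneg_pos)
qed

text \<open>On simple coroots \<open>rho\<close> pairs to 1, so integrality turns a positive pairing
  of \<nu> into a nonnegative one of \<open>\<nu> - rho\<close>.\<close>

lemma strictly_dominant_rho_diff:
  assumes "\<nu> - rho \<in> weight" "\<And>\<alpha>. \<alpha> \<in> Rp \<Longrightarrow> B \<nu> \<alpha> > 0"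
  shows "\<nu> - rho \<in> dominant"
  unfolding dominant_iff
proof (intro conjI ballI)
  fix \<alpha> assume "\<alpha> \<in> Rp"
  then show "B (\<nu> - rho) \<alpha> \<ge> 0"
  proof (induction rule: Rp_induct)
    case (simple i)
    have i: "i \<in> R" using simple_root simple by blast
    have "B (\<nu> - rho) (coroot B i) \<in> \<int>" using assms(1) i by (simp add: weights_def)
    then obtain k :: int where k: "B (\<nu> - rho) (coroot B i) = of_int k" by (auto elim: Ints_cases)
    have "B \<nu> (coroot B i) > 0" using assms(2) simple_Rp[OF simple] pairing_sign(2)[OF i] by blast
    then have "real_of_int k > -1" using k rho_pairing_simple[OF simple] by (simp add: B_simps)
    then have "k \<ge> 0" by linarith
    then show ?case using k pairing_sign(1)[OF i, of "\<nu> - rho"] by simp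
  qed (simp add: B_simps)
qed (rule assms(1))

end

section \<open>Alternating elements of the group algebra\<close>

lift_definition coef :: "('m, 'c::zero) monoid_algebra \<Rightarrow> 'm \<Rightarrow> 'c" is Poly_Mapping.lookup .

lemma coef_eqI: "(\<And>\<nu>. coef a \<nu> = coef b \<nu>) \<Longrightarrow> a = b"
  by transfer (rule poly_mapping_eqI)

lemma finite_coef: "finite {\<nu>. coef a \<nu> \<noteq> 0}"
  by transfer (rule finite_lookup)

lemma coef_zero [simp]: "coef 0 \<nu> = 0"
  by transfer simp

lemma coef_add [simp]: "coef (a + b) \<nu> = coef a \<nu> + coef b \<nu>"
  by transfer (simp add: lookup_add)

lemma coef_mon: "coef (mon c m) \<nu> = (if m = \<nu> then c else 0)"
  by transfer (simp add: lookup_single when_def)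

lemma coef_sum [simp]: "coef (sum g A) \<nu> = (\<Sum>x\<in>A. coef (g x) \<nu>)"
  by (induction A rule: infinite_finite_induct) simp_all

lemma coef_mon_mult [simp]:
  fixes a :: "('m::comm_monoid_add, 'c::comm_ring_1) monoid_algebra"
  shows "coef (mon c 0 * a) \<nu> = c * coef a \<nu>"
  by (induction a rule: monoid_algebra_induct) (simp_all add: mon_mult coef_mon algebra_simps)

lemma mon_zero [simp]: "mon 0 m = 0"
  by transfer simp

lemma mon_uminus: "mon (- c) m = (- mon c m :: ('m::comm_monoid_add, 'c::comm_ring_1) monoid_algebra)"
  by transfer (simp add: single_uminus)

lemma mon_power: "mon c 0 ^ n = (mon (c ^ n) 0 :: ('m::comm_monoid_add, 'c::comm_ring_1) monoid_algebra)"
  by (induction n) (simp_all add: mon_one mon_mult)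

lemma mon_prod:
  "(\<Prod>x\<in>A. mon (c x) (m x)) =
    (mon (\<Prod>x\<in>A. c x) (\<Sum>x\<in>A. m x) :: ('m::comm_monoid_add, 'c::comm_ring_1) monoid_algebra)"
  by (induction A rule: infinite_finite_induct) (simp_all add: mon_one mon_mult)

lemma mon_ne_0: "c \<noteq> 0 \<Longrightarrow> mon c m \<noteq> 0"
  by (metis coef_mon coef_zero)

lemma alg_act_zero [simp]: "alg_act w 0 = 0"
  by transfer simp

lemma alg_act_sum: "alg_act w (sum g A) = (\<Sum>x\<in>A. alg_act w (g x))"
  by (induction A rule: infinite_finite_induct) (simp_all add: alg_act_add)

lemma alg_act_uminus:
  fixes a :: "('m::comm_monoid_add, 'c::comm_ring_1) monoid_algebra"
  shows "alg_act w (- a) = - alg_act w a"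
  using alg_act_add[of w a "- a"] by (simp add: add_eq_0_iff2)

lemma alg_act_diff:
  fixes a b :: "('m::comm_monoid_add, 'c::comm_ring_1) monoid_algebra"
  shows "alg_act w (a - b) = alg_act w a - alg_act w b"
  using alg_act_add[of w a "- b"] by (simp add: alg_act_uminus)

lemma alg_act_comp:
  fixes a :: "('m::comm_monoid_add, 'c::comm_ring_1) monoid_algebra"
  shows "alg_act w (alg_act v a) = alg_act (w \<circ> v) a"
  by (induction a rule: monoid_algebra_induct) (simp_all add: alg_act_add)

lemma coef_alg_act:
  fixes a :: "('m::comm_monoid_add, 'c::comm_ring_1) monoid_algebra"
  assumes "inj w"
  shows "coef (alg_act w a) (w \<nu>) = coef a \<nu>"
  by (induction a rule: monoid_algebra_induct) (simp_all add: alg_act_add coef_mon inj_eq[OF assms])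

lemma alg_act_linear_simps:
  fixes a :: "('v::real_vector, 'c::idom) monoid_algebra"
  assumes "linear w"
  shows "alg_act w 1 = (1 :: ('v, 'c) monoid_algebra)"
    and "alg_act w (a * b) = alg_act w a * alg_act w b"
    and "alg_act w (\<Prod>x\<in>A. g x) = (\<Prod>x\<in>A. alg_act w (g x) :: ('v, 'c) monoid_algebra)"
    and "alg_act w (mon c 0 * a) = mon c 0 * alg_act w a"
proof -
  show 1: "alg_act w 1 = (1 :: ('v, 'c) monoid_algebra)"
    using linear_0[OF assms] by (simp flip: mon_one)
  show 2: "alg_act w (a * b) = alg_act w a * alg_act w b" for a b :: "('v, 'c) monoid_algebra"
    using linear_add[OF assms] by (rule alg_act_mult)
  show "alg_act w (\<Prod>x\<in>A. g x) = (\<Prod>x\<in>A. alg_act w (g x) :: ('v, 'c) monoid_algebra)"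
    by (induction A rule: infinite_finite_induct) (simp_all add: 1 2)
  show "alg_act w (mon c 0 * a) = mon c 0 * alg_act w a"
    using linear_0[OF assms] by (simp add: 2)
qed

lemma to_fract_prod: "to_fract (\<Prod>x\<in>A. g x) = (\<Prod>x\<in>A. to_fract (g x))"
  by (induction A rule: infinite_finite_induct) simp_all

context root_system
begin

lemma sum_W_left_mult:
  assumes "v \<in> W"
  shows "(\<Sum>w\<in>W. g (v \<circ> w)) = (\<Sum>w\<in>W. g w)"
proof (rule sum.reindex_bij_witness[where i = "\<lambda>w. inv v \<circ> w" and j = "\<lambda>w. v \<circ> w"])
  show "inv v \<circ> (v \<circ> w) = w" "v \<circ> (inv v \<circ> w) = w" for w
    using assms by (simp_all add: fun_eq_iff)
qed (use assms W_comp W_inv in auto)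

lemma sg_inv:
  assumes "w \<in> W"
  shows "sg (inv w) = (sg w :: 'c::comm_ring_1)"
proof -
  have "sg w * sg (inv w) = (sg (w \<circ> inv w) :: 'c)"
    using sg_comp assms W_inv by metis
  then have "sg w * (sg w * sg (inv w)) = (sg w :: 'c)" using assms by simp
  then show ?thesis by (simp flip: mult.assoc)
qed

section \<open>Alternants, numerators and the Weyl denominator\<close>

definition alt :: "'v \<Rightarrow> ('v, 'c::comm_ring_1) monoid_algebra"
  where "alt \<mu> = (\<Sum>w\<in>W. mon (sg w) (w \<mu>))"

text \<open>This is \<open>delta\<close> times the summand of \<open>R_function\<close> at the
  identity, so no fractions occur.\<close>

definition numer_term :: "('v \<Rightarrow> 'c::idom) \<Rightarrow> 'v \<Rightarrow> ('v, 'c) monoid_algebra"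
  where "numer_term t lam = mon 1 (lam + rho) * (\<Prod>\<alpha>\<in>Rp. 1 - mon (t \<alpha>) (- \<alpha>))"

text \<open>This is \<open>delta\<close> times \<open>R_function\<close>. The signs appear because
  \<open>delta\<close> is alternating; see \<open>R_function_eq\<close>.\<close>

definition numer :: "('v \<Rightarrow> 'c::idom) \<Rightarrow> 'v \<Rightarrow> ('v, 'c) monoid_algebra"
  where "numer t lam = (\<Sum>w\<in>W. mon (sg w) 0 * alg_act w (numer_term t lam))"

text \<open>The Weyl denominator in product form. As an instance of \<open>numer_term\<close> it
  inherits the expansion over subsets of \<open>Rp\<close>.\<close>

definition delta :: "('v, 'c::idom) monoid_algebra"
  where "delta = numer_term (\<lambda>_. 1) 0"

lemma numer_term_expand:
  "numer_term t lam = (\<Sum>E\<in>Pow Rp. mon ((-1) ^ card E * (\<Prod>\<alpha>\<in>E. t \<alpha>)) (lam + rho - \<Sum>E))"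
proof -
  have m1: "(-1 :: ('v, 'a) monoid_algebra) = mon (-1) 0" by (simp add: mon_uminus mon_one)
  show ?thesis
    unfolding numer_term_def prod_diff_conv_sum[OF finite_Rp] mon_prod m1 mon_power
    by (simp add: sum_distrib_left mon_mult sum_negf)
qed

lemma numer_expand:
  "numer t lam = (\<Sum>w\<in>W. \<Sum>E\<in>Pow Rp.
    mon (sg w * ((-1) ^ card E * (\<Prod>\<alpha>\<in>E. t \<alpha>))) (w (lam + rho - \<Sum>E)))"
  unfolding numer_def numer_term_expand
  by (simp add: alg_act_sum sum_distrib_left mon_mult)

lemma numer_alternating:
  assumes v: "v \<in> W"
  shows "alg_act v (numer t lam) = mon (sg v) 0 * numer t lam"
proof -
  let ?g = "\<lambda>w. mon (sg v * sg w) 0 * alg_act w (numer_term t lam)"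
  have "alg_act v (numer t lam) = (\<Sum>w\<in>W. mon (sg w) 0 * alg_act (v \<circ> w) (numer_term t lam))"
    by (simp add: numer_def alg_act_sum alg_act_linear_simps[OF W_linear[OF v]] alg_act_comp W_simps[OF v])
  also have "\<dots> = (\<Sum>w\<in>W. ?g (v \<circ> w))"
    by (rule sum.cong) (simp_all add: sg_comp[OF v] flip: mult.assoc)
  also have "\<dots> = (\<Sum>w\<in>W. ?g w)" by (rule sum_W_left_mult[OF v])
  also have "\<dots> = mon (sg v) 0 * numer t lam"
    by (simp add: numer_def sum_distrib_left mon_mult flip: mult.assoc)
  finally show ?thesis .
qed

lemma delta_eq: "delta = mon 1 rho * (\<Prod>\<alpha>\<in>Rp. 1 - mon 1 (- \<alpha>))"
  by (simp add: delta_def numer_term_def)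

text \<open>The factors of the positive roots other than \<open>i\<close> are permuted. What remains
  is \<open>mon 1 rho\<close> times the factor of \<open>i\<close>; it becomes
  \<open>mon 1 (rho - i) * (1 - mon 1 i)\<close>, which is its negative.\<close>

lemma delta_simple:
  assumes i: "i \<in> simple"
  shows "alg_act (s i) delta = (- delta :: ('v, 'c::idom) monoid_algebra)"
proof -
  have iR: "i \<in> Rp" "i \<in> R" using i simple_Rp simple_root by auto
  have W: "s i \<in> W" using refl_in_W iR by blast
  let ?h = "\<lambda>\<alpha>. 1 - mon 1 (- \<alpha>) :: ('v, 'c) monoid_algebra"
  have d: "delta = mon 1 rho * (?h i * (\<Prod>\<alpha>\<in>Rp - {i}. ?h \<alpha>))"
    using prod.remove[OF finite_Rp iR(1), of ?h] by (simp add: delta_eq)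
  have "(\<Prod>\<alpha>\<in>Rp - {i}. ?h (s i \<alpha>)) = (\<Prod>\<alpha>\<in>Rp - {i}. ?h \<alpha>)"
  proof (rule prod.reindex_bij_witness[where i = "s i" and j = "s i"])
    fix \<alpha>
    assume \<alpha>: "\<alpha> \<in> Rp - {i}"
    have "- i \<notin> Rp" using not_Rp_iff iR by blast
    then have "s i \<alpha> \<noteq> i" using \<alpha> refl_refl[OF iR(2), of \<alpha>] refl_self[OF iR(2)] by auto
    then show "s i \<alpha> \<in> Rp - {i}" using simple_refl_Rp[OF i] \<alpha> by blast
    then show "s i \<alpha> \<in> Rp - {i}" .
  qed (simp_all add: refl_refl[OF iR(2)])
  then have "alg_act (s i) delta = mon 1 (rho - i) * (?h (- i) * (\<Prod>\<alpha>\<in>Rp - {i}. ?h \<alpha>))"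
    unfolding d
    by (simp add: alg_act_linear_simps[OF W_linear[OF W]] alg_act_diff simple_refl_rho[OF i]
        W_simps[OF W] refl_self[OF iR(2)])
  also have "mon 1 (rho - i) * (?h (- i) * (\<Prod>\<alpha>\<in>Rp - {i}. ?h \<alpha>)) =
      mon 1 (rho - i) * ?h (- i) * (\<Prod>\<alpha>\<in>Rp - {i}. ?h \<alpha>)"
    by (simp only: mult.assoc)
  also have "mon 1 (rho - i) * ?h (- i) = - (mon 1 rho * ?h i)"
    by (simp add: right_diff_distrib mon_mult)
  finally show ?thesis by (simp add: d mult.assoc)
qed

lemma delta_alternating:
  assumes "w \<in> W"
  shows "alg_act w delta = (mon (sg w) 0 * delta :: ('v, 'c::idom) monoid_algebra)"
  using assms
proof (induction rule: W_induct)
  case id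
  have "alg_act id delta = (delta :: ('v, 'c) monoid_algebra)"
    by (rule coef_eqI) (use coef_alg_act[of id] in simp)
  then have "alg_act id delta = (mon (sg id) 0 * delta :: ('v, 'c) monoid_algebra)"
    by (simp add: mon_one)
  then show ?case .
next
  case (comp w i)
  have "alg_act (w \<circ> s i) delta = alg_act w (alg_act (s i) (delta :: ('v, 'c) monoid_algebra))"
    by (rule alg_act_comp[symmetric])
  also have "\<dots> = - alg_act w delta" by (simp only: delta_simple[OF comp.hyps(2)] alg_act_uminus)
  also have "alg_act w delta = (mon (sg w) 0 * delta :: ('v, 'c) monoid_algebra)" by (rule comp.IH)
  also have "- (mon (sg w) 0 * delta) = (mon (sg (w \<circ> s i)) 0 * delta :: ('v, 'c) monoid_algebra)"
    using comp.hyps by (simp add: sg_comp_simple mon_uminus)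
  finally show ?case .
qed

lemma coef_delta_nonzero:
  assumes "coef (delta :: ('v, 'c::idom) monoid_algebra) \<nu> \<noteq> 0"
  shows "rho - \<nu> \<in> root_cone"
proof -
  obtain E where "E \<in> Pow Rp" and
    "coef (mon ((-1) ^ card E * (\<Prod>\<alpha>\<in>E. 1)) (0 + rho - \<Sum>E) :: ('v, 'c) monoid_algebra) \<nu> \<noteq> 0"
    using assms unfolding delta_def numer_term_expand coef_sum
    by (rule sum.not_neutral_contains_not_neutral)
  then have "E \<subseteq> Rp" "\<nu> = rho - \<Sum>E" by (auto simp: coef_mon split: if_splits)
  then show ?thesis using root_cone_sum finite_subset[OF _ finite_Rp] by auto
qed

text \<open>A nonempty set of positive roots has nonzero sum, so only the empty subset
  contributes.\<close>

lemma coef_delta_rho: "coef delta rho = 1"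
proof -
  have "coef delta rho = (\<Sum>E\<in>Pow Rp. if E = {} then 1 else 0)"
    unfolding delta_def numer_term_expand coef_sum
    by (rule sum.cong) (use root_cone_sum_eq_0 in \<open>auto simp: coef_mon\<close>)
  also have "\<dots> = 1" by (simp add: finite_Rp)
  finally show ?thesis .
qed

lemma delta_nonzero: "delta \<noteq> 0"
  using coef_delta_rho by (metis coef_zero zero_neq_one)

section \<open>Alternating elements as combinations of alternants\<close>

lemma coef_alt_nonzero: "coef (alt x) \<nu> \<noteq> 0 \<Longrightarrow> \<exists>w\<in>W. \<nu> = w x"
  unfolding alt_def coef_sum
  by (drule sum.not_neutral_contains_not_neutral) (auto simp: coef_mon split: if_splits)

text \<open>A strictly dominant vector has trivial stabilizer, so the terms of its alternant have
  distinct exponents.\<close>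

lemma coef_alt:
  assumes "w \<in> W" "\<And>\<alpha>. \<alpha> \<in> Rp \<Longrightarrow> B x \<alpha> > 0"
  shows "coef (alt x) (w x) = sg w"
proof -
  have "u = w" if "u \<in> W" "u x = w x" for u
  proof -
    have "inv w \<circ> u = id"
      using strictly_dominant_unique[of "inv w \<circ> u" x] assms that W_comp W_inv by auto
    then have "w \<circ> (inv w \<circ> u) = w" by simp
    then show ?thesis using assms(1) by (simp flip: comp_assoc)
  qed
  then have "coef (alt x) (w x) = (\<Sum>u\<in>W. if u = w then sg u else 0)"
    unfolding alt_def coef_sum by (intro sum.cong) (auto simp: coef_mon)
  then show ?thesis using assms(1) finite_W by simp
qed

lemma alternating_coef:
  assumes "\<And>w. w \<in> W \<Longrightarrow> alg_act w a = mon (sg w) 0 * a" and w: "w \<in> W"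
  shows "coef a (w \<nu>) = sg w * coef a \<nu>"
proof -
  have "coef a \<nu> = sg w * coef a (w \<nu>)"
    using coef_alg_act[OF W_inj[OF w], of a \<nu>] assms(1)[OF w] by simp
  then have "sg w * coef a \<nu> = (sg w * sg w) * coef a (w \<nu>)" by (simp only: mult.assoc)
  then show ?thesis by simp
qed

lemma finite_coef_shift: "finite {\<mu>\<in>X. coef a (\<mu> + rho) \<noteq> 0}"
proof (rule finite_subset)
  show "{\<mu>\<in>X. coef a (\<mu> + rho) \<noteq> 0} \<subseteq> (\<lambda>\<nu>. \<nu> - rho) ` {\<nu>. coef a \<nu> \<noteq> 0}"
    by (force simp: image_iff)
qed (simp add: finite_coef)

text \<open>Both sides are compared at each exponent. An exponent with nonzero coefficient is
  orthogonal to no root, so it is conjugate to \<open>\<mu> + rho\<close> for exactly one dominant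
  \<mu>, and only that alternant reaches it.\<close>

lemma alternating_expansion:
  fixes a :: "('v, 'c::idom) monoid_algebra"
  assumes two: "(2::'c) \<noteq> 0"
    and alternating: "\<And>w. w \<in> W \<Longrightarrow> alg_act w a = mon (sg w) 0 * a"
    and support: "\<And>\<nu>. coef a \<nu> \<noteq> 0 \<Longrightarrow> \<nu> - rho \<in> weight"
  shows "a = (\<Sum>\<mu>\<in>{\<mu>\<in>dominant. coef a (\<mu> + rho) \<noteq> 0}. mon (coef a (\<mu> + rho)) 0 * alt (\<mu> + rho))"
    (is "a = (\<Sum>\<mu>\<in>?D. ?g \<mu>)")
proof (rule coef_eqI)
  fix \<nu>
  have ac: "coef a (w \<nu>) = sg w * coef a \<nu>" if "w \<in> W" for w \<nu>
    by (rule alternating_coef[OF _ that]) (rule alternating)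
  show "coef a \<nu> = coef (\<Sum>\<mu>\<in>?D. ?g \<mu>) \<nu>"
  proof (cases "coef a \<nu> = 0")
    case True
    have "coef (?g \<mu>) \<nu> = 0" if \<mu>: "\<mu> \<in> ?D" for \<mu>
    proof (rule ccontr)
      assume "coef (?g \<mu>) \<nu> \<noteq> 0"
      then have "coef (alt (\<mu> + rho) :: ('v, 'c) monoid_algebra) \<nu> \<noteq> 0" by auto
      then obtain w where w: "w \<in> W" "\<nu> = w (\<mu> + rho)" using coef_alt_nonzero by blast
      then have "sg w * coef a (\<mu> + rho) = 0" using ac True by simp
      then have "(sg w * sg w) * coef a (\<mu> + rho) = 0" by (simp only: mult.assoc mult_zero_right)
      then show False using \<mu> by simp
    qed
    then show ?thesis using True by simp
  next
    case False
    \<comment> \<open>On a reflecting hyperplane the coefficient equals its own negative, hence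
      vanishes because 2 is not zero in the domain.\<close>
    have reg: "B \<nu> \<alpha> \<noteq> 0" if \<alpha>: "\<alpha> \<in> R" for \<alpha>
    proof
      assume "B \<nu> \<alpha> = 0"
      then have "s \<alpha> \<nu> = \<nu>" by (simp add: refl_eq)
      then have "coef a \<nu> = - coef a \<nu>"
        using ac[OF refl_in_W[OF \<alpha>], of \<nu>] by (simp add: sg_refl[OF \<alpha>])
      then have "coef a \<nu> + coef a \<nu> = 0" by (simp only: eq_neg_iff_add_eq_0)
      then have "2 * coef a \<nu> = 0" by (simp only: mult_2)
      then show False using two False by simp
    qed
    obtain w where w: "w \<in> W" "\<And>\<alpha>. \<alpha> \<in> Rp \<Longrightarrow> B (w \<nu>) \<alpha> \<ge> 0"
      using exists_dominant_conj by blast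
    have iw: "inv w \<in> W" using W_inv w by blast
    have pos: "B (w \<nu>) \<alpha> > 0" if \<alpha>: "\<alpha> \<in> Rp" for \<alpha>
    proof -
      have "B (w \<nu>) \<alpha> = B \<nu> (inv w \<alpha>)" using W_isometry[OF w(1), of \<nu> "inv w \<alpha>"] w by simp
      then have "B (w \<nu>) \<alpha> \<noteq> 0" using reg W_root[OF iw] Rp_root \<alpha> by simp
      then show ?thesis using w(2)[OF \<alpha>] by simp
    qed
    define \<mu> where "\<mu> = w \<nu> - rho"
    have wn: "coef a (w \<nu>) = sg w * coef a \<nu>" using ac w by blast
    have "sg w * coef a (w \<nu>) = (sg w * sg w) * coef a \<nu>" unfolding wn by (simp only: mult.assoc)
    then have "coef a (w \<nu>) \<noteq> 0" using False by auto
    then have \<mu>: "\<mu> \<in> ?D"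
      using strictly_dominant_rho_diff[OF support pos] by (simp add: \<mu>_def)
    have \<nu>: "\<nu> = inv w (\<mu> + rho)" using w by (simp add: \<mu>_def)
    \<comment> \<open>Two strictly dominant vectors in one orbit coincide, so no other alternant has
      a term at \<nu>.\<close>
    have other: "coef (?g \<mu>') \<nu> = 0" if \<mu>': "\<mu>' \<in> ?D" "\<mu>' \<noteq> \<mu>" for \<mu>'
    proof (rule ccontr)
      assume "coef (?g \<mu>') \<nu> \<noteq> 0"
      then have "coef (alt (\<mu>' + rho) :: ('v, 'c) monoid_algebra) \<nu> \<noteq> 0" by auto
      then obtain u where u: "u \<in> W" "\<nu> = u (\<mu>' + rho)" using coef_alt_nonzero by blast
      have "w \<circ> u = id"
      proof (rule strictly_dominant_unique)
        show "w \<circ> u \<in> W" using W_comp w u by blast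
        show "B (\<mu>' + rho) \<alpha> > 0" if "\<alpha> \<in> Rp" for \<alpha>
          using strictly_dominant_rho_add \<mu>' that by blast
        show "B ((w \<circ> u) (\<mu>' + rho)) \<alpha> > 0" if "\<alpha> \<in> Rp" for \<alpha>
          using pos[OF that] u by simp
      qed
      then have "w \<nu> = \<mu>' + rho" using u(2) by (metis comp_apply id_apply)
      then show False using \<mu>'(2) by (simp add: \<mu>_def)
    qed
    have "coef (\<Sum>\<mu>\<in>?D. ?g \<mu>) \<nu> = (\<Sum>\<mu>'\<in>?D. if \<mu>' = \<mu> then coef (?g \<mu>) \<nu> else 0)"
      unfolding coef_sum by (rule sum.cong) (use other in auto)
    also have "\<dots> = coef (?g \<mu>) \<nu>" using \<mu> finite_coef_shift[of dominant a] by simp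
    also have "\<dots> = coef a (\<mu> + rho) * coef (alt (\<mu> + rho)) (inv w (\<mu> + rho))"
      unfolding \<nu>[symmetric] by simp
    also have "coef (alt (\<mu> + rho)) (inv w (\<mu> + rho)) = (sg w :: 'c)"
      unfolding sg_inv[OF w(1), symmetric] by (rule coef_alt[OF iw]) (simp add: \<mu>_def pos)
    also have "coef a (\<mu> + rho) * sg w = (sg w * sg w) * coef a \<nu>"
      using wn by (simp add: \<mu>_def mult_ac)
    finally show ?thesis by simp
  qed
qed

lemma zero_dominant: "0 \<in> dominant"
  by (simp add: dominant_iff weights_def B_simps)

text \<open>Only dominant \<mu> below 0 can occur in the expansion, and 0 is the only one.\<close>

lemma alternating_top:
  fixes a :: "('v, 'c::idom) monoid_algebra"
  assumes two: "(2::'c) \<noteq> 0"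
    and alternating: "\<And>w. w \<in> W \<Longrightarrow> alg_act w a = mon (sg w) 0 * a"
    and support: "\<And>\<nu>. coef a \<nu> \<noteq> 0 \<Longrightarrow> rho - \<nu> \<in> root_cone"
  shows "a = mon (coef a rho) 0 * alt rho"
proof -
  let ?D = "{\<mu>\<in>dominant. coef a (\<mu> + rho) \<noteq> 0}"
  have "\<nu> - rho \<in> weight" if "coef a \<nu> \<noteq> 0" for \<nu>
    using weight_diff[OF root_cone_weight[OF root_cone_zero] root_cone_weight[OF support[OF that]]] by simp
  then have "a = (\<Sum>\<mu>\<in>?D. mon (coef a (\<mu> + rho)) 0 * alt (\<mu> + rho))"
    by (intro alternating_expansion two alternating)
  also have "\<dots> = (\<Sum>\<mu>\<in>{0}. mon (coef a (\<mu> + rho)) 0 * alt (\<mu> + rho))"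
  proof (rule sum.mono_neutral_left)
    show "?D \<subseteq> {0}" using dominant_root_cone_eq_0 support by force
    show "\<forall>\<mu>\<in>{0} - ?D. mon (coef a (\<mu> + rho)) 0 * alt (\<mu> + rho) = 0"
      by (auto simp: zero_dominant)
  qed simp
  finally show ?thesis by simp
qed

text \<open>The Weyl denominator formula: \<open>delta\<close> is alternating, supported below
  \<open>rho\<close>, with coefficient 1 there.\<close>

lemma delta_eq_alt:
  assumes "(2::'c::idom) \<noteq> 0"
  shows "delta = (alt rho :: ('v, 'c) monoid_algebra)"
proof -
  have "delta = (mon (coef delta rho) 0 * alt rho :: ('v, 'c) monoid_algebra)"
    by (rule alternating_top[OF assms delta_alternating coef_delta_nonzero])
  then show ?thesis unfolding coef_delta_rho mon_one by simp
qed

section \<open>Support and leading coefficient of the numerator\<close>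

lemma W_shift:
  assumes "w \<in> W" "E \<subseteq> Rp"
  shows "\<exists>F\<subseteq>Rp. w (lam + rho - \<Sum>E) = w lam + rho - \<Sum>F \<and> (F = {} \<longleftrightarrow> E = inversions' w)"
proof -
  show ?thesis
  proof (rule W_half_sum_diff[OF assms])
    fix F assume F: "F \<subseteq> Rp" "w (rho - \<Sum>E) = rho - \<Sum>F" "F = {} \<longleftrightarrow> E = inversions' w"
    have "w (lam + rho - \<Sum>E) = w lam + w (rho - \<Sum>E)"
      by (simp only: W_simps(1)[OF assms(1), symmetric] add_diff_eq)
    then show ?thesis using F by (auto simp: add_diff_eq)
  qed
qed

text \<open>Each exponent is \<open>w lam + rho - \<Sum>F\<close>, so the difference in question is
  \<open>lam - w lam\<close> plus \<open>\<Sum>F\<close>, two elements of the cone.\<close>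

lemma numer_support:
  assumes "lam \<in> dominant" "coef (numer t lam) \<nu> \<noteq> 0"
  shows "lam - (\<nu> - rho) \<in> root_cone"
proof -
  obtain w where w: "w \<in> W" and "(\<Sum>E\<in>Pow Rp. coef
    (mon (sg w * ((-1) ^ card E * (\<Prod>\<alpha>\<in>E. t \<alpha>))) (w (lam + rho - \<Sum>E))) \<nu>) \<noteq> 0"
    using assms(2) unfolding numer_expand coef_sum by (rule sum.not_neutral_contains_not_neutral)
  then obtain E where "E \<in> Pow Rp" and
    "coef (mon (sg w * ((-1) ^ card E * (\<Prod>\<alpha>\<in>E. t \<alpha>))) (w (lam + rho - \<Sum>E))) \<nu> \<noteq> 0"
    by (meson sum.not_neutral_contains_not_neutral)
  then have E: "E \<subseteq> Rp" "\<nu> = w (lam + rho - \<Sum>E)" by (auto simp: coef_mon split: if_splits)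
  obtain F where F: "F \<subseteq> Rp" "w (lam + rho - \<Sum>E) = w lam + rho - \<Sum>F"
    using W_shift[OF w E(1)] by blast
  have eq: "lam - (\<nu> - rho) = (lam - w lam) + \<Sum>F" using E F by simp
  show ?thesis
    unfolding eq using dominant_diff_root_cone[OF assms(1) w]
      root_cone_sum[OF finite_subset[OF F(1) finite_Rp] F(1)] by (rule root_cone_add)
qed

text \<open>The exponent \<open>lam + rho\<close> occurs only if both parts of that difference
  vanish. So each \<open>w\<close> fixing \<open>lam\<close> contributes the single subset
  \<open>E = inversions Rp w\<close>, and other \<open>w\<close> contribute nothing.\<close>

lemma numer_top:
  assumes "lam \<in> dominant"
  shows "coef (numer t lam) (lam + rho) = stabilizer_weight_sum B R Rp t lam"
proof -
  have inner: "(\<Sum>E\<in>Pow Rp. coef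
      (mon (sg w * ((-1) ^ card E * (\<Prod>\<alpha>\<in>E. t \<alpha>))) (w (lam + rho - \<Sum>E))) (lam + rho)) =
      (if w lam = lam then \<Prod>\<alpha>\<in>inversions' w. t \<alpha> else 0)" if w: "w \<in> W" for w
  proof -
    have iff: "w (lam + rho - \<Sum>E) = lam + rho \<longleftrightarrow> w lam = lam \<and> E = inversions' w"
      if E: "E \<subseteq> Rp" for E
    proof -
      obtain F where F: "F \<subseteq> Rp" "w (lam + rho - \<Sum>E) = w lam + rho - \<Sum>F"
        "F = {} \<longleftrightarrow> E = inversions' w"
        using W_shift[OF w E] by blast
      note cone = dominant_diff_root_cone[OF assms w] root_cone_sum[OF finite_subset[OF F(1) finite_Rp] F(1)]
      have "w (lam + rho - \<Sum>E) = lam + rho \<longleftrightarrow> (lam - w lam) + \<Sum>F = 0"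
        unfolding F(2) by (auto simp: algebra_simps)
      also have "\<dots> \<longleftrightarrow> w lam = lam \<and> F = {}"
        using root_cone_add_eq_0[OF cone] root_cone_sum_eq_0[OF F(1)] by auto
      finally show ?thesis using F(3) by simp
    qed
    have "(\<Sum>E\<in>Pow Rp. coef
      (mon (sg w * ((-1) ^ card E * (\<Prod>\<alpha>\<in>E. t \<alpha>))) (w (lam + rho - \<Sum>E))) (lam + rho)) =
      (\<Sum>E\<in>Pow Rp. if E = inversions' w
        then (if w lam = lam then sg w * ((-1) ^ card E * (\<Prod>\<alpha>\<in>E. t \<alpha>)) else 0) else 0)"
      by (rule sum.cong) (auto simp: coef_mon iff)
    \<comment> \<open>For this \<open>E\<close> the sign from the expansion is \<open>sg w\<close>
      once more, and the two signs cancel.\<close>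
    also have "\<dots> = (if w lam = lam then sg w * (sg w * (\<Prod>\<alpha>\<in>inversions' w. t \<alpha>)) else 0)"
      by (subst sum.delta) (auto simp: finite_Rp sg_def inversions_def)
    finally show ?thesis by (simp flip: mult.assoc)
  qed
  have "coef (numer t lam) (lam + rho) = (\<Sum>w\<in>W. if w lam = lam then \<Prod>\<alpha>\<in>inversions' w. t \<alpha> else 0)"
    unfolding numer_expand coef_sum by (rule sum.cong) (simp_all add: inner)
  then show ?thesis
    by (simp add: stabilizer_weight_sum_def weyl_stabilizer_def finite_W sum.inter_filter)
qed

text \<open>At weight 0 the symmetrization is constant: only the term at \<open>rho\<close>
  survives, and its coefficient is the weighted sum over all of \<open>W\<close>, since
  \<open>W\<close> fixes 0.\<close>

lemma numer_zero:
  assumes "(2::'c::idom) \<noteq> 0"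
  shows "numer t 0 = (mon (\<Sum>w\<in>W. \<Prod>\<alpha>\<in>inversions' w. t \<alpha>) 0 * delta :: ('v, 'c) monoid_algebra)"
proof -
  have "{w\<in>W. w 0 = 0} = W" using W_simps(5) by blast
  then have "coef (numer t 0) rho = (\<Sum>w\<in>W. \<Prod>\<alpha>\<in>inversions' w. t \<alpha>)"
    using numer_top[OF zero_dominant, of t]
    by (simp add: stabilizer_weight_sum_def weyl_stabilizer_def)
  moreover have "numer t 0 = mon (coef (numer t 0) rho) 0 * alt rho"
  proof (rule alternating_top[OF assms numer_alternating])
    show "rho - \<nu> \<in> root_cone" if "coef (numer t 0) \<nu> \<noteq> 0" for \<nu>
      using numer_support[OF zero_dominant that] by simp
  qed
  ultimately show ?thesis by (simp only: delta_eq_alt[OF assms])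
qed

section \<open>Return to the fraction field\<close>

lemma alternant_eq:
  "alternant B R Rp \<mu> = to_fract (alt \<mu> :: ('v, 'c::idom) monoid_algebra)"
proof -
  have "(-1) ^ weyl_length B Rp w * to_fract (mon 1 (w \<mu>)) =
      to_fract (mon (sg w) (w \<mu>) :: ('v, 'c) monoid_algebra)"
    if "w \<in> W" for w
    by (cases "even (card (inversions' w))")
      (simp_all add: weyl_length_eq[OF that] sg_def mon_uminus)
  then show ?thesis by (simp add: alternant_def alt_def)
qed

text \<open>Every summand is put over the common denominator \<open>delta\<close>. Acting by
  \<open>w\<close> multiplies \<open>delta\<close> by \<open>sg w\<close>, which moves to the
  numerator because it is its own inverse.\<close>

lemma R_function_eq:
  fixes t :: "'v \<Rightarrow> 'c::idom"
  shows "R_function B R Rp t lam = to_fract (numer t lam) / to_fract delta"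
proof -
  let ?q = "xpow lam * (\<Prod>\<alpha>\<in>Rp. (1 - scalar (t \<alpha>) * xpow (- \<alpha>)) / (1 - xpow (- \<alpha>)))"
  have N: "numer_term t lam = mon 1 rho * (mon 1 lam * (\<Prod>\<alpha>\<in>Rp. 1 - mon (t \<alpha>) (- \<alpha>)))"
    by (simp add: numer_term_def mon_mult add.commute flip: mult.assoc)
  have rho0: "mon 1 rho \<noteq> (0 :: ('v, 'c) monoid_algebra)" by (simp add: mon_ne_0)
  have m: "scalar c * xpow x = to_fract (mon c x)" for c :: 'c and x :: 'v
    by (simp add: mon_mult flip: to_fract_mult)
  \<comment> \<open>Extending the fraction by \<open>mon 1 rho\<close> completes the product of the
    factors \<open>1 - mon 1 (- \<alpha>)\<close> to \<open>delta\<close>.\<close>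
  have q: "?q = Fract (numer_term t lam) delta"
    using rho0 unfolding m by (simp add: Fract_conv_to_fract N delta_eq to_fract_prod prod_dividef)
  have "fract_act w ?q = to_fract (mon (sg w) 0 * alg_act w (numer_term t lam)) / to_fract delta"
    if w: "w \<in> W" for w
  proof -
    have sq: "mon (sg w) 0 * mon (sg w) 0 = (1 :: ('v, 'c) monoid_algebra)" by (simp add: mon_mult mon_one)
    then have s0: "mon (sg w) 0 \<noteq> (0 :: ('v, 'c) monoid_algebra)" by auto
    have "fract_act w ?q = Fract (alg_act w (numer_term t lam)) (mon (sg w) 0 * delta)"
      unfolding q fract_act_Fract[OF W_linear[OF w] W_inj[OF w] delta_nonzero] delta_alternating[OF w] ..
    also have "\<dots> = Fract (mon (sg w) 0 * alg_act w (numer_term t lam)) delta"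
    proof (subst eq_fract)
      have "(mon (sg w) 0 * alg_act w (numer_term t lam)) * (mon (sg w) 0 * delta) =
          (mon (sg w) 0 * mon (sg w) 0) * (alg_act w (numer_term t lam) * delta)"
        by (simp only: mult_ac)
      then show "alg_act w (numer_term t lam) * delta =
          (mon (sg w) 0 * alg_act w (numer_term t lam)) * (mon (sg w) 0 * delta)"
        unfolding sq by simp
    qed (use s0 delta_nonzero in auto)
    finally show ?thesis by (simp add: Fract_conv_to_fract)
  qed
  then show ?thesis
    by (simp add: R_function_def numer_def sum_divide_distrib)
qed

subsection \<open>Expansions into Weyl characters\<close>

lemma to_fract_alternating:
  fixes a :: "('v, 'c::idom) monoid_algebra"
  assumes "(2::'c) \<noteq> 0"
    and "\<And>w. w \<in> W \<Longrightarrow> alg_act w a = mon (sg w) 0 * a"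
    and "\<And>\<nu>. coef a \<nu> \<noteq> 0 \<Longrightarrow> \<nu> - rho \<in> weight"
  shows "to_fract a / to_fract delta =
    (\<Sum>\<mu>\<in>{\<mu>\<in>dominant. coef a (\<mu> + rho) \<noteq> 0}. scalar (coef a (\<mu> + rho)) * weyl_character B R Rp \<mu>)"
proof -
  have "to_fract a = (\<Sum>\<mu>\<in>{\<mu>\<in>dominant. coef a (\<mu> + rho) \<noteq> 0}.
      scalar (coef a (\<mu> + rho)) * to_fract (alt (\<mu> + rho)))"
    by (subst alternating_expansion[OF assms]) simp_all
  then show ?thesis
    by (simp add: weyl_character_def alternant_eq sum_divide_distrib flip: delta_eq_alt[OF assms(1)])
qed

lemma numer_weight:
  assumes "lam \<in> dominant" "coef (numer t lam) \<nu> \<noteq> 0"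
  shows "\<nu> - rho \<in> weight"
proof -
  have "lam - (lam - (\<nu> - rho)) \<in> weight"
    using weight_diff root_cone_weight[OF numer_support[OF assms]] assms(1)
    by (simp only: dominant_iff)
  then show ?thesis by simp
qed

lemma R_function_expansion:
  fixes t :: "'v \<Rightarrow> 'c::idom"
  assumes "(2::'c) \<noteq> 0" "lam \<in> dominant"
  shows "R_function B R Rp t lam = (\<Sum>\<mu>\<in>{\<mu>\<in>dominant. coef (numer t lam) (\<mu> + rho) \<noteq> 0}.
    scalar (coef (numer t lam) (\<mu> + rho)) * weyl_character B R Rp \<mu>)"
  unfolding R_function_eq
  by (rule to_fract_alternating[OF assms(1) numer_alternating numer_weight[OF assms(2)]])

lemma coef_numer_dominance:
  assumes "lam \<in> dominant" "\<not> dominance_le Rp \<mu> lam"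
  shows "coef (numer t lam) (\<mu> + rho) = 0"
  using numer_support[OF assms(1), of t "\<mu> + rho"] assms(2) by (auto simp: dominance_le_iff)

section \<open>Divisibility by the stabilizer sum for equal parameters\<close>

text \<open>Keeping the functional \<open>f\<close> makes the positive roots of the subsystem those
  positive roots that are orthogonal to \<open>lam\<close>.\<close>

lemma orthogonal_root_system: "root_system B {\<alpha>\<in>R. B lam \<alpha> = 0} f"
proof (rule root_system.intro)
  show "c = 1 \<or> c = -1"
    if "\<alpha> \<in> {\<alpha>\<in>R. B lam \<alpha> = 0}" "c *\<^sub>R \<alpha> \<in> {\<alpha>\<in>R. B lam \<alpha> = 0}" for \<alpha> c
    using reduced[of \<alpha> c] that by simp
  show "refl_root B \<alpha> \<beta> \<in> {\<alpha>\<in>R. B lam \<alpha> = 0}"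
    if "\<alpha> \<in> {\<alpha>\<in>R. B lam \<alpha> = 0}" "\<beta> \<in> {\<alpha>\<in>R. B lam \<alpha> = 0}" for \<alpha> \<beta>
    using that refl_root_closed by (auto simp: refl_eq B_simps)
qed (use bilinear sym pos_def finite_roots zero_not_root integral linear_f f_nonzero in auto)

text \<open>The positive roots not orthogonal to \<open>lam\<close> contribute a factor invariant under the stabilizer,
  which leaves the sum for the orthogonal root system at the weight \<open>0\<close>.\<close>

lemma stabilizer_numer:
  fixes t :: "'c::idom"
  assumes two: "(2::'c) \<noteq> 0" and lam: "lam \<in> dominant"
  obtains a where "(\<Sum>v\<in>weyl_stabilizer B R lam. mon (sg v) 0 * alg_act v (numer_term (\<lambda>_. t) lam)) =
    mon (stabilizer_weight_sum B R Rp (\<lambda>_. t) lam) 0 * a"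
proof -
  let ?J = "{\<alpha>\<in>R. B lam \<alpha> = 0}"
  interpret J: root_system B ?J f by (rule orthogonal_root_system)
  have Jp: "J.Rp = {\<alpha>\<in>Rp. B lam \<alpha> = 0}" by (auto simp: J.Rp_def Rp_def)
  then have JpRp: "J.Rp \<subseteq> Rp" by blast
  have stab: "v \<in> W \<and> v lam = lam" if "v \<in> J.W" for v
    using that
  proof (induction rule: weyl_group.induct)
    case weyl_id
    have "id \<in> W \<and> id lam = lam" by (simp add: weyl_group.weyl_id)
    then show ?case .
  next
    case (weyl_refl v \<alpha>)
    have "s \<alpha> \<circ> v \<in> W" using weyl_refl by (intro weyl_group.weyl_refl) auto
    moreover have "(s \<alpha> \<circ> v) lam = lam" using weyl_refl by (simp add: refl_eq)
    ultimately have "s \<alpha> \<circ> v \<in> W \<and> (s \<alpha> \<circ> v) lam = lam" by blast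
    then show ?case .
  qed
  have JW: "J.W = weyl_stabilizer B R lam"
    using stab dominant_stabilizer[OF lam] by (auto simp: weyl_stabilizer_def)
  \<comment> \<open>Dominance makes the product with \<open>lam\<close> positive on these roots, and
    the stabilizer preserves that product; a negative root cannot have it positive.\<close>
  have outer: "v \<alpha> \<in> Rp - J.Rp" if v: "v \<in> J.W" and \<alpha>: "\<alpha> \<in> Rp - J.Rp" for v \<alpha>
  proof -
    have vW: "v \<in> W" "v lam = lam" using stab v by auto
    have "B lam (v \<alpha>) = B lam \<alpha>" using W_isometry[OF vW(1), of lam \<alpha>] vW by simp
    moreover have "B lam \<alpha> > 0" using \<alpha> lam by (force simp: dominant_iff Jp)
    ultimately have p: "B lam (v \<alpha>) > 0" by simp
    have "v \<alpha> \<in> Rp"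
    proof (rule ccontr)
      assume "v \<alpha> \<notin> Rp"
      then have "- v \<alpha> \<in> Rp" using not_Rp_iff W_root[OF vW(1)] Rp_root \<alpha> by blast
      then have "B lam (- v \<alpha>) \<ge> 0" using lam by (simp add: dominant_iff)
      then show False using p by (simp add: B_simps)
    qed
    then show ?thesis using p by (simp add: Jp)
  qed
  have outer_image: "v ` (Rp - J.Rp) = Rp - J.Rp" if v: "v \<in> J.W" for v
  proof
    show "v ` (Rp - J.Rp) \<subseteq> Rp - J.Rp" using outer v by blast
    show "Rp - J.Rp \<subseteq> v ` (Rp - J.Rp)"
    proof
      fix \<alpha> assume "\<alpha> \<in> Rp - J.Rp"
      then have "inv v \<alpha> \<in> Rp - J.Rp" using outer J.W_inv v by blast
      then show "\<alpha> \<in> v ` (Rp - J.Rp)" using W_image_iff stab v by blast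
    qed
  qed
  \<comment> \<open>Positive roots outside the subsystem are never inverted by the stabilizer, so
    inversions and signs may be computed in either system.\<close>
  have inv: "inversions' v = J.inversions' v" if v: "v \<in> J.W" for v
  proof -
    have vW: "v \<in> W" using stab v by blast
    have "v \<alpha> \<in> Rp \<longleftrightarrow> v \<alpha> \<in> J.Rp" if "\<alpha> \<in> J.Rp" for \<alpha>
      using J.W_root[OF v J.Rp_root[OF that]] by (auto simp: Jp)
    then show ?thesis
      using outer[OF v] JpRp unfolding inversions_eq[OF vW] J.inversions_eq[OF v] by blast
  qed
  have sg: "sg v = J.sg v" if "v \<in> J.W" for v
    using inv[OF that] by (simp add: sg_def J.sg_def)
  \<comment> \<open>All that is left of \<open>numer_term\<close> once the factors of the subsystem
    and its own half sum are removed. It involves only the outer roots and \<open>lam\<close>, so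
    equal parameters make it invariant.\<close>
  define K :: "('v, 'c) monoid_algebra"
    where "K = mon 1 (lam + (rho - J.rho)) * (\<Prod>\<alpha>\<in>Rp - J.Rp. 1 - mon t (- \<alpha>))"
  have N: "numer_term (\<lambda>_. t) lam = K * J.numer_term (\<lambda>_. t) 0"
  proof -
    have "(\<Prod>\<alpha>\<in>Rp. 1 - mon t (- \<alpha>)) =
        (\<Prod>\<alpha>\<in>Rp - J.Rp. 1 - mon t (- \<alpha>)) * (\<Prod>\<alpha>\<in>J.Rp. 1 - mon t (- \<alpha>) :: ('v, 'c) monoid_algebra)"
      by (rule prod.subset_diff[OF JpRp finite_Rp])
    moreover have "mon 1 (lam + rho) = (mon 1 (lam + (rho - J.rho)) * mon 1 J.rho :: ('v, 'c) monoid_algebra)"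
      by (simp add: mon_mult)
    ultimately show ?thesis by (simp add: numer_term_def J.numer_term_def K_def mult_ac)
  qed
  have rho_diff: "rho - J.rho = half_sum (Rp - J.Rp)"
    using sum_diff[OF finite_Rp JpRp, of "\<lambda>x. x"] by (simp add: half_sum_def scaleR_diff_right)
  have K: "alg_act v K = K" if v: "v \<in> J.W" for v
  proof -
    have vW: "v \<in> W" "v lam = lam" using stab v by auto
    have "(\<Prod>\<alpha>\<in>Rp - J.Rp. 1 - mon t (- v \<alpha>)) =
        (\<Prod>\<alpha>\<in>v ` (Rp - J.Rp). 1 - mon t (- \<alpha>) :: ('v, 'c) monoid_algebra)"
      using W_inj[OF vW(1)] by (simp add: prod.reindex inj_on_subset[OF _ subset_UNIV])
    also have "\<dots> = (\<Prod>\<alpha>\<in>Rp - J.Rp. 1 - mon t (- \<alpha>))" by (simp only: outer_image[OF v])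
    finally have 1: "(\<Prod>\<alpha>\<in>Rp - J.Rp. 1 - mon t (- v \<alpha>)) =
        (\<Prod>\<alpha>\<in>Rp - J.Rp. 1 - mon t (- \<alpha>) :: ('v, 'c) monoid_algebra)" .
    have "v (rho - J.rho) = rho - J.rho"
      unfolding rho_diff half_sum_image[OF vW(1)] outer_image[OF v] ..
    then have 2: "v (lam + (rho - J.rho)) = lam + (rho - J.rho)"
      by (simp only: W_simps(1)[OF vW(1)] vW(2))
    show ?thesis
      unfolding K_def alg_act_linear_simps(2,3)[OF W_linear[OF vW(1)]] alg_act_mon 2 alg_act_diff
        alg_act_linear_simps(1)[OF W_linear[OF vW(1)]] W_simps(3)[OF vW(1)] 1 ..
  qed
  have "(\<Sum>v\<in>J.W. mon (sg v) 0 * alg_act v (numer_term (\<lambda>_. t) lam)) = K * J.numer (\<lambda>_. t) 0"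
    unfolding J.numer_def sum_distrib_left
  proof (rule sum.cong)
    fix v assume v: "v \<in> J.W"
    then have "linear v" using W_linear stab by blast
    then show "mon (sg v) 0 * alg_act v (numer_term (\<lambda>_. t) lam) =
        K * (mon (J.sg v) 0 * alg_act v (J.numer_term (\<lambda>_. t) 0))"
      unfolding N by (simp add: alg_act_linear_simps(2) K[OF v] sg[OF v] mult_ac)
  qed simp
  also have "\<dots> = mon (\<Sum>w\<in>J.W. \<Prod>\<alpha>\<in>J.inversions' w. t) 0 * (K * J.delta)"
    unfolding J.numer_zero[OF two] by (simp only: mult_ac)
  also have "(\<Sum>w\<in>J.W. \<Prod>\<alpha>\<in>J.inversions' w. t) = stabilizer_weight_sum B R Rp (\<lambda>_. t) lam"
    unfolding stabilizer_weight_sum_def JW[symmetric] by (rule sum.cong) (simp_all add: inv)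
  finally show thesis using that unfolding JW by blast
qed

text \<open>The group is split into left cosets of the stabilizer. The sum over the coset of
  \<open>u\<close> is, up to sign, the image under \<open>u\<close> of the sum over the stabilizer,
  hence a multiple of the same constant, which \<open>u\<close> leaves alone.\<close>

lemma stabilizer_weight_sum_dvd:
  fixes t :: "'c::idom"
  assumes two: "(2::'c) \<noteq> 0" and lam: "lam \<in> dominant"
  shows "stabilizer_weight_sum B R Rp (\<lambda>_. t) lam dvd coef (numer (\<lambda>_. t) lam) \<nu>"
proof -
  let ?c = "stabilizer_weight_sum B R Rp (\<lambda>_. t) lam"
  let ?g = "\<lambda>w. mon (sg w) 0 * alg_act w (numer_term (\<lambda>_. t) lam)"
  obtain a where a: "(\<Sum>v\<in>weyl_stabilizer B R lam. ?g v) = mon ?c 0 * a"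
    using stabilizer_numer[OF assms] by blast
  have coset: "?c dvd coef (\<Sum>w\<in>{w\<in>W. w lam = \<kappa>}. ?g w) \<nu>" if \<kappa>: "\<kappa> \<in> (\<lambda>w. w lam) ` W" for \<kappa>
  proof -
    obtain u where u: "u \<in> W" "\<kappa> = u lam" using \<kappa> by blast
    have comp_inv: "u \<circ> (inv u \<circ> w) = w" "inv u \<circ> (u \<circ> w) = w" for w
      using u(1) by (simp_all add: fun_eq_iff)
    have "(\<Sum>w\<in>{w\<in>W. w lam = \<kappa>}. ?g w) = (\<Sum>v\<in>weyl_stabilizer B R lam. ?g (u \<circ> v))"
    proof (rule sum.reindex_bij_witness[where i = "\<lambda>v. u \<circ> v" and j = "\<lambda>w. inv u \<circ> w"])
      show "u \<circ> (inv u \<circ> w) = w" "inv u \<circ> (u \<circ> w) = w" for w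
        by (rule comp_inv)+
      show "?g (u \<circ> (inv u \<circ> w)) = ?g w" for w by (simp only: comp_inv)
    qed (use u W_comp W_inv in \<open>auto simp: weyl_stabilizer_def\<close>)
    also have "\<dots> = mon (sg u) 0 * alg_act u (\<Sum>v\<in>weyl_stabilizer B R lam. ?g v)"
      unfolding alg_act_sum sum_distrib_left
    proof (rule sum.cong)
      fix v assume "v \<in> weyl_stabilizer B R lam"
      then have v: "v \<in> W" by (simp add: weyl_stabilizer_def)
      show "?g (u \<circ> v) = mon (sg u) 0 * alg_act u (?g v)"
        unfolding alg_act_linear_simps(4)[OF W_linear[OF u(1)]] alg_act_comp sg_comp[OF u(1) v]
        by (simp add: mon_mult flip: mult.assoc)
    qed simp
    also have "\<dots> = mon ?c 0 * (mon (sg u) 0 * alg_act u a)"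
      unfolding a alg_act_linear_simps(4)[OF W_linear[OF u(1)]] by (simp only: mult_ac)
    finally show ?thesis by (simp only: coef_mon_mult dvd_triv_left)
  qed
  \<comment> \<open>The coset of \<open>w\<close> is recorded by the vector
    \<open>w lam\<close>.\<close>
  have "numer (\<lambda>_. t) lam = (\<Sum>\<kappa>\<in>(\<lambda>w. w lam) ` W. \<Sum>w\<in>{w\<in>W. w lam = \<kappa>}. ?g w)"
    unfolding numer_def by (rule sum.image_gen[OF finite_W])
  then show ?thesis
    using dvd_sum[of "(\<lambda>w. w lam) ` W", OF coset] by (simp only: coef_sum[of _ "(\<lambda>w. w lam) ` W"])
qed

lemma stabilizer_poincare_eq:
  "stabilizer_poincare B R Rp t lam = stabilizer_weight_sum B R Rp (\<lambda>_. t) lam"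
  unfolding stabilizer_poincare_def stabilizer_weight_sum_def
  by (rule sum.cong) (simp_all add: weyl_stabilizer_def weyl_length_eq)

text \<open>At the value 1 of the variable this polynomial counts the stabilizer, which contains the
  identity.\<close>

lemma stabilizer_poincare_nonzero:
  "stabilizer_poincare B R Rp ([:0, 1:] :: int poly) lam \<noteq> 0"
proof
  assume "stabilizer_poincare B R Rp ([:0, 1:] :: int poly) lam = 0"
  then have "poly (stabilizer_poincare B R Rp ([:0, 1:] :: int poly) lam) 1 = 0" by simp
  then have "card (weyl_stabilizer B R lam) = 0"
    by (simp add: stabilizer_poincare_def poly_sum poly_power)
  moreover have "finite (weyl_stabilizer B R lam)" using finite_W by (simp add: weyl_stabilizer_def)
  moreover have "id \<in> weyl_stabilizer B R lam" by (simp add: weyl_stabilizer_def weyl_group.weyl_id)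
  ultimately show False by auto
qed

lemma macdonald_spherical_expansion:
  assumes lam: "lam \<in> dominant"
  shows "\<exists>c :: 'v \<Rightarrow> int poly.
    finite {\<mu>\<in>dominant. c \<mu> \<noteq> 0} \<and>
    macdonald_spherical B R Rp [:0, 1:] lam =
      (\<Sum>\<mu>\<in>{\<mu>\<in>dominant. c \<mu> \<noteq> 0}. scalar (c \<mu>) * weyl_character B R Rp \<mu>) \<and>
    (\<forall>\<mu>\<in>dominant. \<not> dominance_le Rp \<mu> lam \<longrightarrow> c \<mu> = 0) \<and> c lam = 1"
proof -
  let ?t = "[:0, 1:] :: int poly"
  let ?p = "stabilizer_poincare B R Rp ?t lam"
  let ?u = "\<lambda>\<mu>. coef (numer (\<lambda>_. ?t) lam) (\<mu> + rho)"
  let ?sc = "\<lambda>c. scalar c :: ('v, int poly) monoid_algebra fract"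
  note p0 = stabilizer_poincare_nonzero[of lam]
  have "?p dvd ?u \<mu>" for \<mu>
    unfolding stabilizer_poincare_eq by (rule stabilizer_weight_sum_dvd[OF _ lam]) simp
  \<comment> \<open>The coefficients for (b) are the exact quotients by \<open>?p\<close>. For \<mu>
    = \<open>lam\<close> the dividend is \<open>?p\<close> itself, hence the value 1.\<close>
  then obtain c where c: "\<And>\<mu>. ?u \<mu> = ?p * c \<mu>" unfolding dvd_def by metis
  have D: "{\<mu>\<in>dominant. c \<mu> \<noteq> 0} = {\<mu>\<in>dominant. ?u \<mu> \<noteq> 0}" using p0 by (simp add: c)
  have "macdonald_spherical B R Rp ?t lam = 1 / scalar ?p * R_function B R Rp (\<lambda>_. ?t) lam"
    by (simp only: macdonald_spherical_def R_function_def)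
  also have "R_function B R Rp (\<lambda>_. ?t) lam =
      (\<Sum>\<mu>\<in>{\<mu>\<in>dominant. c \<mu> \<noteq> 0}. scalar (?u \<mu>) * weyl_character B R Rp \<mu>)"
    unfolding D by (rule R_function_expansion[OF _ lam]) simp
  also have "1 / scalar ?p * \<dots> =
      (\<Sum>\<mu>\<in>{\<mu>\<in>dominant. c \<mu> \<noteq> 0}. scalar (c \<mu>) * weyl_character B R Rp \<mu>)"
    unfolding sum_distrib_left
  proof (rule sum.cong)
    fix \<mu>
    have "?sc (?u \<mu>) = ?sc ?p * ?sc (c \<mu>)"
      unfolding c by (simp add: mon_mult flip: to_fract_mult)
    moreover have "?sc ?p \<noteq> 0" using p0 by (simp add: mon_ne_0)
    ultimately show "1 / ?sc ?p * (?sc (?u \<mu>) * weyl_character B R Rp \<mu>) =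
        ?sc (c \<mu>) * weyl_character B R Rp \<mu>" by simp
  qed simp
  finally have "macdonald_spherical B R Rp ?t lam = \<dots>" .
  moreover have "finite {\<mu>\<in>dominant. c \<mu> \<noteq> 0}" unfolding D by (rule finite_coef_shift)
  moreover have "c \<mu> = 0" if "\<not> dominance_le Rp \<mu> lam" for \<mu>
    using coef_numer_dominance[OF lam that] c p0 by (metis mult_eq_0_iff)
  moreover have "c lam = 1"
  proof -
    have "?p * c lam = ?u lam" by (rule c[symmetric])
    also have "\<dots> = ?p" unfolding stabilizer_poincare_eq by (rule numer_top[OF lam])
    finally show ?thesis using p0 by simp
  qed
  ultimately show ?thesis by blast
qed

end

section \<open>Polynomials in the variables of the positive roots\<close>

lemma mpolys_in_zero: "0 \<in> mpolys_in I"
  unfolding mpolys_in_def by (simp add: zero_monoid_algebra.rep_eq)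

lemma mpolys_in_one: "1 \<in> mpolys_in I"
  unfolding mpolys_in_def by (simp add: one_monoid_algebra.rep_eq)

lemma mpolys_in_add:
  assumes "p \<in> mpolys_in I" "q \<in> mpolys_in I"
  shows "p + q \<in> mpolys_in I"
  unfolding mpolys_in_def
proof (intro CollectI ballI)
  fix m assume "m \<in> Poly_Mapping.keys (to_poly_mapping (p + q))"
  then have "m \<in> Poly_Mapping.keys (to_poly_mapping p) \<union> Poly_Mapping.keys (to_poly_mapping q)"
    unfolding plus_monoid_algebra.rep_eq by (rule subsetD[OF Poly_Mapping.keys_add])
  then show "Poly_Mapping.keys m \<subseteq> I" using assms by (auto simp: mpolys_in_def)
qed

lemma mpolys_in_uminus: "p \<in> mpolys_in I \<Longrightarrow> - p \<in> mpolys_in I"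
  unfolding mpolys_in_def by (simp add: uminus_monoid_algebra.rep_eq)

lemma mpolys_in_mult:
  assumes "p \<in> mpolys_in I" "q \<in> mpolys_in I"
  shows "p * q \<in> mpolys_in I"
  unfolding mpolys_in_def
proof (intro CollectI ballI)
  fix m assume "m \<in> Poly_Mapping.keys (to_poly_mapping (p * q))"
  then obtain a b where ab: "a \<in> Poly_Mapping.keys (to_poly_mapping p)"
      "b \<in> Poly_Mapping.keys (to_poly_mapping q)" "m = a + b"
    unfolding times_monoid_algebra.rep_eq using keys_mult by blast
  then show "Poly_Mapping.keys m \<subseteq> I"
    using assms Poly_Mapping.keys_add[of a b] unfolding mpolys_in_def by blast
qed

lemma mpolys_in_sum: "(\<And>x. x \<in> A \<Longrightarrow> g x \<in> mpolys_in I) \<Longrightarrow> sum g A \<in> mpolys_in I"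
  by (induction A rule: infinite_finite_induct) (simp_all add: mpolys_in_zero mpolys_in_add)

lemma mpolys_in_prod: "(\<And>x. x \<in> A \<Longrightarrow> g x \<in> mpolys_in I) \<Longrightarrow> prod g A \<in> mpolys_in I"
  by (induction A rule: infinite_finite_induct) (simp_all add: mpolys_in_one mpolys_in_mult)

lemma mpolys_in_power: "p \<in> mpolys_in I \<Longrightarrow> p ^ n \<in> mpolys_in I"
  by (induction n) (simp_all add: mpolys_in_one mpolys_in_mult)

lemma mpolys_in_mvar: "i \<in> I \<Longrightarrow> mvar i \<in> mpolys_in I"
  by (simp add: mpolys_in_def mvar_def mon.rep_eq)

lemma int_mpoly_two: "(2 :: 'i int_mpoly) \<noteq> 0"
proof
  assume "(2 :: 'i int_mpoly) = 0"
  then have "coef (1 + 1 :: 'i int_mpoly) 0 = 0" by simp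
  then show False by (simp only: coef_add coef_mon flip: mon_one) simp
qed

lemma (in root_system) coef_numer_mpolys_in: "coef (numer mvar lam) \<nu> \<in> mpolys_in Rp"
  unfolding numer_expand coef_sum coef_mon sg_def
  by (auto intro!: mpolys_in_sum mpolys_in_mult mpolys_in_power mpolys_in_prod mpolys_in_mvar
      mpolys_in_uminus mpolys_in_one simp: mpolys_in_zero)

text \<open>The given form need not be definite. This one is, and it has the same reflections.\<close>

definition canonical_form :: "('v::real_vector \<Rightarrow> 'v \<Rightarrow> real) \<Rightarrow> 'v set \<Rightarrow> 'v \<Rightarrow> 'v \<Rightarrow> real"
  where "canonical_form B R x y = (\<Sum>\<alpha>\<in>R. B x (coroot B \<alpha>) * B y (coroot B \<alpha>))"

text \<open>Reflections permute the coroots, so they preserve the canonical form. Applying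
  \<open>refl_root B \<alpha>\<close> to both arguments expresses its value at \<open>v\<close> and
  \<alpha> through the pairing and its value at \<alpha> and \<alpha>, which determines the new
  coroot pairing.\<close>

lemma canonical_form_pairing:
  assumes bil: "bilinear B" and sym: "\<And>x y. B x y = B y x" and fin: "finite R"
    and nz: "\<And>\<alpha>. \<alpha> \<in> R \<Longrightarrow> B \<alpha> \<alpha> \<noteq> 0" and closed: "\<And>\<alpha>. \<alpha> \<in> R \<Longrightarrow> refl_root B \<alpha> ` R = R"
    and \<alpha>: "\<alpha> \<in> R"
  shows "canonical_form B R v (coroot (canonical_form B R) \<alpha>) = B v (coroot B \<alpha>)"
proof -
  let ?K = "canonical_form B R"
  let ?s = "refl_root B \<alpha>"
  note Bs = bilinear_ladd[OF bil] bilinear_radd[OF bil] bilinear_lmul[OF bil] bilinear_rmul[OF bil]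
    bilinear_lsub[OF bil] bilinear_rsub[OF bil] bilinear_lneg[OF bil] bilinear_rneg[OF bil]
  have iso: "B (?s x) (?s y) = B x y" for x y
    using nz[OF \<alpha>] sym[of \<alpha> x] sym[of \<alpha> y] by (simp add: refl_root_def coroot_def Bs field_simps)
  have scale: "?s (c *\<^sub>R x) = c *\<^sub>R ?s x" for c x
    by (simp add: refl_root_def Bs algebra_simps)
  have coroot: "coroot B (?s \<beta>) = ?s (coroot B \<beta>)" for \<beta>
    by (simp add: coroot_def iso scale)
  have inj: "inj_on ?s R" using closed[OF \<alpha>] fin by (simp add: eq_card_imp_inj_on)
  have "?K (?s x) (?s y) = (\<Sum>\<beta>\<in>?s ` R. B (?s x) (coroot B \<beta>) * B (?s y) (coroot B \<beta>))" for x y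
    by (simp only: canonical_form_def closed[OF \<alpha>])
  then have K_iso: "?K (?s x) (?s y) = ?K x y" for x y
    by (simp add: sum.reindex[OF inj] coroot iso canonical_form_def)
  have two: "B \<alpha> (coroot B \<alpha>) = 2" using nz[OF \<alpha>] by (simp add: coroot_def Bs)
  have K_bil: "?K (x - c *\<^sub>R z) (- y) = - ?K x y + c * ?K z y" for x y z c
    by (simp add: canonical_form_def Bs sum_negf sum.distrib sum_distrib_left algebra_simps sum_subtractf)
  have "?s \<alpha> = - \<alpha>" by (simp add: refl_root_def two scaleR_2)
  then have "?K v \<alpha> = ?K (v - B v (coroot B \<alpha>) *\<^sub>R \<alpha>) (- \<alpha>)"
    using K_iso[of v \<alpha>] by (simp add: refl_root_def)
  then have eq: "2 * ?K v \<alpha> = B v (coroot B \<alpha>) * ?K \<alpha> \<alpha>" unfolding K_bil by simp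
  \<comment> \<open>A sum of squares in which the term of \<alpha> is 4.\<close>
  have "?K \<alpha> \<alpha> \<noteq> 0"
  proof
    assume "?K \<alpha> \<alpha> = 0"
    then have "B \<alpha> (coroot B \<alpha>) * B \<alpha> (coroot B \<alpha>) = 0"
      using fin \<alpha> unfolding canonical_form_def by (subst (asm) sum_nonneg_eq_0_iff) auto
    then show False using two by simp
  qed
  then have "B v (coroot B \<alpha>) = 2 * ?K v \<alpha> / ?K \<alpha> \<alpha>" using eq by simp
  also have "\<dots> = ?K v (coroot ?K \<alpha>)"
    unfolding coroot_def[of ?K] by (simp add: canonical_form_def[of B R v] Bs sum_distrib_left mult_ac sum_divide_distrib)
  finally show ?thesis by simp
qed

text \<open>If this sum of squares vanishes, \<open>x\<close> is orthogonal to all roots. They span,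
  so nondegeneracy of \<open>B\<close> gives \<open>x = 0\<close>.\<close>

lemma canonical_form_pos:
  assumes bil: "bilinear B" and nondeg: "\<And>x. (\<And>y. B x y = 0) \<Longrightarrow> x = 0" and fin: "finite R"
    and span: "span R = UNIV" and nz: "\<And>\<alpha>. \<alpha> \<in> R \<Longrightarrow> B \<alpha> \<alpha> \<noteq> 0" and "x \<noteq> 0"
  shows "canonical_form B R x x > 0"
proof (rule ccontr)
  assume "\<not> canonical_form B R x x > 0"
  moreover have "canonical_form B R x x \<ge> 0" unfolding canonical_form_def by (rule sum_nonneg) simp
  ultimately have "canonical_form B R x x = 0" by simp
  then have "B x (coroot B \<alpha>) * B x (coroot B \<alpha>) = 0" if "\<alpha> \<in> R" for \<alpha>
    using fin that unfolding canonical_form_def by (subst (asm) sum_nonneg_eq_0_iff) auto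
  then have 0: "B x \<alpha> = 0" if "\<alpha> \<in> R" for \<alpha>
    using that nz[OF that] by (force simp: coroot_def bilinear_rmul[OF bil])
  have "linear (\<lambda>y. B x y)" using bil by (simp add: bilinear_def)
  then have "B x y = 0" for y
    using linear_eq_0_on_span[of "\<lambda>y. B x y" R y] 0 span by simp
  then show False using nondeg assms(6) by blast
qed

section \<open>Transport between forms with the same reflections\<close>

lemma weyl_group_cong:
  assumes "\<And>\<alpha>. \<alpha> \<in> R \<Longrightarrow> refl_root B \<alpha> = refl_root C \<alpha>"
  shows "weyl_group B R = weyl_group C R"
proof -
  have sub: "weyl_group B R \<subseteq> weyl_group C R"
    if "\<And>\<alpha>. \<alpha> \<in> R \<Longrightarrow> refl_root B \<alpha> = refl_root C \<alpha>" for B C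
  proof
    fix w assume "w \<in> weyl_group B R"
    then show "w \<in> weyl_group C R"
    proof (induction rule: weyl_group.induct)
      case weyl_id
      show ?case by (rule weyl_group.weyl_id)
    next
      case (weyl_refl w \<alpha>)
      have "refl_root B \<alpha> \<circ> w \<in> weyl_group C R"
        unfolding that[OF weyl_refl.hyps(2)] using weyl_refl by (intro weyl_group.weyl_refl)
      then show ?case .
    qed
  qed
  show ?thesis using sub[of B C] sub[of C B] assms by fastforce
qed

lemma weyl_length_cong:
  assumes "\<And>\<alpha>. \<alpha> \<in> Rp \<Longrightarrow> refl_root B \<alpha> = refl_root C \<alpha>"
  shows "weyl_length B Rp = weyl_length C Rp"
proof
  fix w
  have "foldr (\<lambda>\<alpha> g. refl_root B \<alpha> \<circ> g) \<alpha>s id = foldr (\<lambda>\<alpha> g. refl_root C \<alpha> \<circ> g) \<alpha>s id"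
    if "set \<alpha>s \<subseteq> simple_roots Rp" for \<alpha>s
    by (rule foldr_cong) (use that assms in \<open>auto simp: simple_roots_def\<close>)
  then have "(\<exists>\<alpha>s. set \<alpha>s \<subseteq> simple_roots Rp \<and> length \<alpha>s = n \<and>
        w = foldr (\<lambda>\<alpha> g. refl_root B \<alpha> \<circ> g) \<alpha>s id) \<longleftrightarrow>
      (\<exists>\<alpha>s. set \<alpha>s \<subseteq> simple_roots Rp \<and> length \<alpha>s = n \<and>
        w = foldr (\<lambda>\<alpha> g. refl_root C \<alpha> \<circ> g) \<alpha>s id)" for n
    by metis
  then show "weyl_length B Rp w = weyl_length C Rp w" by (simp only: weyl_length_def)
qed

theorem lemma2p16:
  fixes B :: "'v::real_vector \<Rightarrow> 'v \<Rightarrow> real" and R Rp :: "'v set" and lam :: 'v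
  assumes "reduced_irreducible_root_system B R"
    and "positive_system R Rp"
    and "lam \<in> dominant_weights B R Rp"
  shows
    "(\<exists>u :: 'v \<Rightarrow> 'v int_mpoly.
        (\<forall>\<mu>\<in>dominant_weights B R Rp. u \<mu> \<in> mpolys_in Rp) \<and>
        finite {\<mu>\<in>dominant_weights B R Rp. u \<mu> \<noteq> 0} \<and>
        R_function B R Rp mvar lam =
          (\<Sum>\<mu>\<in>{\<mu>\<in>dominant_weights B R Rp. u \<mu> \<noteq> 0}. scalar (u \<mu>) * weyl_character B R Rp \<mu>) \<and>
        (\<forall>\<mu>\<in>dominant_weights B R Rp. \<not> dominance_le Rp \<mu> lam \<longrightarrow> u \<mu> = 0) \<and>
        u lam = stabilizer_weight_sum B R Rp mvar lam) \<and>
     (\<exists>c :: 'v \<Rightarrow> int poly.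
        finite {\<mu>\<in>dominant_weights B R Rp. c \<mu> \<noteq> 0} \<and>
        macdonald_spherical B R Rp [:0, 1:] lam =
          (\<Sum>\<mu>\<in>{\<mu>\<in>dominant_weights B R Rp. c \<mu> \<noteq> 0}. scalar (c \<mu>) * weyl_character B R Rp \<mu>) \<and>
        (\<forall>\<mu>\<in>dominant_weights B R Rp. \<not> dominance_le Rp \<mu> lam \<longrightarrow> c \<mu> = 0) \<and>
        c lam = 1)"
proof -
  let ?K = "canonical_form B R"
  note rs = assms(1)[unfolded reduced_irreducible_root_system_def]
  have bil: "bilinear B" and sym: "\<And>x y. B x y = B y x" and nondeg: "\<And>x. (\<And>y. B x y = 0) \<Longrightarrow> x = 0"
    and fin: "finite R" and span: "span R = UNIV" and zero: "0 \<notin> R"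
    and nz: "\<And>\<alpha>. \<alpha> \<in> R \<Longrightarrow> B \<alpha> \<alpha> \<noteq> 0" and closed: "\<And>\<alpha>. \<alpha> \<in> R \<Longrightarrow> refl_root B \<alpha> ` R = R"
    and int: "\<And>\<alpha> \<beta>. \<alpha> \<in> R \<Longrightarrow> \<beta> \<in> R \<Longrightarrow> B \<beta> (coroot B \<alpha>) \<in> \<int>"
    and red: "\<And>\<alpha> c. \<alpha> \<in> R \<Longrightarrow> c *\<^sub>R \<alpha> \<in> R \<Longrightarrow> c = 1 \<or> c = -1"
    using rs by auto
  obtain f :: "'v \<Rightarrow> real" where f: "linear f" "\<forall>\<alpha>\<in>R. f \<alpha> \<noteq> 0" "Rp = {\<alpha>\<in>R. f \<alpha> > 0}"
    using assms(2) unfolding positive_system_def by blast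
  have pair: "?K v (coroot ?K \<alpha>) = B v (coroot B \<alpha>)" if "\<alpha> \<in> R" for v \<alpha>
    by (rule canonical_form_pairing[OF bil sym fin nz closed that])
  have refl: "refl_root B \<alpha> = refl_root ?K \<alpha>" if "\<alpha> \<in> R" for \<alpha>
    by (rule ext) (simp add: refl_root_def pair[OF that])
  interpret K: root_system ?K R f
  proof (rule root_system.intro)
    show "bilinear ?K"
      by (auto simp: bilinear_def canonical_form_def linear_iff bilinear_ladd[OF bil]
          bilinear_lmul[OF bil] sum.distrib sum_distrib_left algebra_simps)
    show "?K x y = ?K y x" for x y by (simp add: canonical_form_def mult.commute)
    show "x \<noteq> 0 \<Longrightarrow> ?K x x > 0" for x by (rule canonical_form_pos[OF bil nondeg fin span nz])
    show "refl_root ?K \<alpha> \<beta> \<in> R" if "\<alpha> \<in> R" "\<beta> \<in> R" for \<alpha> \<beta>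
      using closed[OF that(1)] refl[OF that(1)] that(2) by auto
    show "?K \<beta> (coroot ?K \<alpha>) \<in> \<int>" if "\<alpha> \<in> R" "\<beta> \<in> R" for \<alpha> \<beta>
      using int that by (simp add: pair)
    show "\<alpha> \<in> R \<Longrightarrow> c *\<^sub>R \<alpha> \<in> R \<Longrightarrow> c = 1 \<or> c = -1" for \<alpha> c by (rule red)
  qed (use fin zero f in auto)
  \<comment> \<open>Everything in the statement depends on the form only through coroot pairings and
    reflections, so it may be read for the canonical form.\<close>
  have Rp: "Rp = K.Rp" by (simp add: f(3) K.Rp_def)
  have W: "weyl_group B R = K.W" by (rule weyl_group_cong[OF refl])
  have len: "weyl_length B K.Rp = weyl_length ?K K.Rp"
    by (rule weyl_length_cong) (simp add: refl K.Rp_root)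
  have "weights B R = K.weight" by (simp add: weights_def pair)
  then have dom: "dominant_weights B R K.Rp = K.dominant"
    by (simp add: dominant_weights_def pair K.Rp_root)
  \<comment> \<open>Left general in the coefficient ring, as it serves both for the multivariate
    polynomials in (a) and for \<open>int poly\<close> in (b).\<close>
  have chi: "weyl_character B R K.Rp = (weyl_character ?K R K.Rp :: 'v \<Rightarrow> ('v, 'c::idom) monoid_algebra fract)"
    by (rule ext) (simp add: weyl_character_def alternant_def W len)
  have RF: "R_function B R K.Rp mvar lam = R_function ?K R K.Rp mvar lam"
    by (simp add: R_function_def W)
  have stab: "weyl_stabilizer B R lam = weyl_stabilizer ?K R lam" by (simp add: weyl_stabilizer_def W)
  have sws: "stabilizer_weight_sum B R K.Rp mvar lam = stabilizer_weight_sum ?K R K.Rp mvar lam"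
    by (simp add: stabilizer_weight_sum_def stab)
  have ms: "macdonald_spherical B R K.Rp ([:0, 1:] :: int poly) lam = macdonald_spherical ?K R K.Rp [:0, 1:] lam"
    by (simp add: macdonald_spherical_def stabilizer_poincare_def W stab len)
  have lam: "lam \<in> K.dominant" using assms(3) by (simp add: Rp dom)
  have "\<exists>u :: 'v \<Rightarrow> 'v int_mpoly. (\<forall>\<mu>\<in>K.dominant. u \<mu> \<in> mpolys_in K.Rp) \<and>
      finite {\<mu>\<in>K.dominant. u \<mu> \<noteq> 0} \<and>
      R_function ?K R K.Rp mvar lam =
        (\<Sum>\<mu>\<in>{\<mu>\<in>K.dominant. u \<mu> \<noteq> 0}. scalar (u \<mu>) * weyl_character ?K R K.Rp \<mu>) \<and>
      (\<forall>\<mu>\<in>K.dominant. \<not> dominance_le K.Rp \<mu> lam \<longrightarrow> u \<mu> = 0) \<and>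
      u lam = stabilizer_weight_sum ?K R K.Rp mvar lam"
    \<comment> \<open>The witness is the numerator's coefficient at \<mu> shifted by
      \<open>rho\<close>, the strictly dominant exponent of the alternant belonging to
      \<mu>.\<close>
    by (intro exI[of _ "\<lambda>\<mu>. coef (K.numer mvar lam) (\<mu> + K.rho)"] conjI ballI impI)
      (use lam in \<open>simp_all add: K.coef_numer_mpolys_in K.finite_coef_shift
        K.R_function_expansion int_mpoly_two K.coef_numer_dominance K.numer_top\<close>)
  then show ?thesis
    using K.macdonald_spherical_expansion[OF lam] unfolding Rp dom chi RF sws ms by (rule conjI)
qed

end
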